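(* Let $\mathbb{F}$ be a field of characteristic $p$ ($p=0$ or $p$ prime). Let $f=g/h\in\mathbb{F}(X)$ with $g,h\in\mathbb{F}[X]$ coprime and $d=\deg f=\max\{\deg g,\deg h\}\ge 2$. Assume that $f$ is not a monomial, is not a binomial of the form $aX^{p^{\ell}}+b$ (with $a\ne0$, $b\in\mathbb{F}$, $\ell\ge 0$ an integer; when $p=0$ this exclusion is vacuous since $d\ge 2$), and is not linearly conjugate to $1/X^d$. For $n\ge1$ put $$\Psi(n)=\min_{\substack{k_1,\dots,k_n\in\mathbb{Z}\\ k_n\ne0}}\deg\Big(\big(f^{(1)}\big)^{k_1}\cdots\big(f^{(n)}\big)^{k_n}\Big).$$ Let $e$ be the smallest positive integer $k$ such that $0$ is a zero of $f^{(k)}$ (with $e=\infty$ if there is no such $k$). Then: (i) If $f\in\mathbb{F}[X]$, then $\Psi(n)\ge d^n$ if $n\le e$, and $\Psi(n)\ge d^{n-e}$ otherwise. (ii) If $\deg g>\deg h\ge1$ or $1\le\deg g<\deg h$, then $\Psi(n)\ge d^{n-1}$ for all $n\ge1$. (iii) Suppose that either $\deg g=0<\deg h$ or $\deg g=\deg h$, and suppose moreover that $f$ is separable or $f$ is not of the form $L(X^{p^{\ell}})$ with $L\in\mathbb{F}(X)$ of degree $1$ and $\ell\ge1$. Then there exists an integer $j\ge0$ such that for all $n\ge1$, $\Psi(n)\ge d^n$ if $n\le j$ and $\Psi(n)\ge d^{n-j}$ otherwise.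
   Context: A nonconstant rational function $f\in\mathbb{F}(X)$ is written in lowest terms $f=g/h$ with $\gcd(g,h)=1$; its degree is $\deg f=\max\{\deg g,\deg h\}$. Zeros (resp. poles) of $f$ are the roots in an algebraic closure $\overline{\mathbb{F}}$ of the numerator $g$ (resp. denominator $h$). Iterates: $f^{(0)}(X)=X$, $f^{(k)}=f\circ f^{(k-1)}$ for $k\ge1$. Two rational functions $\phi,\phi'\in\mathbb{F}(X)$ are linearly conjugate if $\phi'=\psi^{-1}\circ\phi\circ\psi$ for some $\psi\in\mathbb{F}(X)$ of degree $1$. $f$ is separable if its derivative is nonzero (i.e. $f\notin\mathbb{F}(X^p)$ when $p>0$; every nonconstant $f$ is separable when $p=0$).
   Formalization: "Monomial" is taken to include aX^k with negative k, so every f = a/X^d is excluded; otherwise (iii) fails, e.g. f = 2/X^2 over Q is not linearly conjugate to 1/X^2 over Q, but f^(2)(f^(1))^2 is constant, so Ψ(2) = 0. *)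

theory Defs
  imports "HOL-Computational_Algebra.Computational_Algebra"
          "HOL-Library.Extended_Nat"
begin

type_synonym 'a ratfun = "'a poly fract"

definition rf_quot :: "'a::field ratfun \<Rightarrow> 'a poly \<times> 'a poly" where
  "rf_quot f = (SOME (g, h). f = to_fract g / to_fract h \<and> coprime g h \<and> lead_coeff h = 1)"

definition rf_num :: "'a::field ratfun \<Rightarrow> 'a poly" where
  "rf_num f = fst (rf_quot f)"

definition rf_den :: "'a::field ratfun \<Rightarrow> 'a poly" where
  "rf_den f = snd (rf_quot f)"

definition rf_deg :: "'a::field ratfun \<Rightarrow> nat" where
  "rf_deg f = max (degree (rf_num f)) (degree (rf_den f))"

definition rf_X :: "'a::field ratfun" where
  "rf_X = to_fract [:0, 1:]"

definition rf_const :: "'a::field \<Rightarrow> 'a ratfun" where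
  "rf_const c = to_fract [:c:]"

definition poly_at_rf :: "'a::field poly \<Rightarrow> 'a ratfun \<Rightarrow> 'a ratfun" where
  "poly_at_rf p u = poly (map_poly rf_const p) u"

definition rf_comp :: "'a::field ratfun \<Rightarrow> 'a ratfun \<Rightarrow> 'a ratfun" where
  "rf_comp f u = poly_at_rf (rf_num f) u / poly_at_rf (rf_den f) u"

primrec rf_iter :: "nat \<Rightarrow> 'a::field ratfun \<Rightarrow> 'a ratfun" where
  "rf_iter 0 f = rf_X"
| "rf_iter (Suc k) f = rf_comp f (rf_iter k f)"

definition lin_conj :: "'a::field ratfun \<Rightarrow> 'a ratfun \<Rightarrow> bool" where
  "lin_conj \<phi> \<phi>' \<longleftrightarrow> (\<exists>\<psi> \<psi>i. rf_deg \<psi> = 1 \<and> rf_comp \<psi>i \<psi> = rf_X \<and> rf_comp \<psi> \<psi>i = rf_X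
        \<and> \<phi>' = rf_comp \<psi>i (rf_comp \<phi> \<psi>))"

definition rf_deriv :: "'a::field ratfun \<Rightarrow> 'a ratfun" where
  "rf_deriv f = to_fract (pderiv (rf_num f) * rf_den f - rf_num f * pderiv (rf_den f))
                 / to_fract (rf_den f ^ 2)"

definition rf_separable :: "'a::field ratfun \<Rightarrow> bool" where
  "rf_separable f \<longleftrightarrow> rf_deriv f \<noteq> 0"

definition rf_monomial :: "'a::field ratfun \<Rightarrow> bool" where
  "rf_monomial f \<longleftrightarrow> (\<exists>a k. a \<noteq> 0 \<and> f = rf_const a * rf_X powi k)"

definition zero_at_0 :: "'a::field ratfun \<Rightarrow> bool" where
  "zero_at_0 f \<longleftrightarrow> poly (rf_num f) 0 = 0"

definition zero_index :: "'a::field ratfun \<Rightarrow> enat" where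
  "zero_index f = (if \<exists>k>0. zero_at_0 (rf_iter k f)
                   then enat (LEAST k. k > 0 \<and> zero_at_0 (rf_iter k f)) else \<infinity>)"

definition Psi :: "'a::field ratfun \<Rightarrow> nat \<Rightarrow> nat" where
  "Psi f n = Inf {rf_deg (\<Prod>i\<in>{1..n}. rf_iter i f powi k i) | k :: nat \<Rightarrow> int. k n \<noteq> 0}"

end

(*
  Let K be an algebraic closure of F, let act be the self-map of the projective line P^1(K) induced
  by f, S = {0, infinity} and orb the forward orbit of S, all of whose points are F-rational.
  With f^(n) = G_n/H_n, a polynomial N over F that divides G_n or H_n and has no root in common
  with G_m and H_m for m < n cannot cancel in a product of powers of iterates, so that product
  has degree at least deg N.

  If y lies outside orb, reaches S after s steps and not before, and Q is its minimal polynomial,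
  then the numerator of Q(f^(n-s)) is such an N, of degree deg Q * d^(n-s).  Let t be the
  first time at which S returns to S.  If no point outside orb reaches S after t steps, then f
  permutes orb, so 0 and infinity have one preimage each and f = (A/B)^d up to a constant, with A, B
  linear.  Multiplying A/B by a d-th root of unity other than 1, which exists unless d is a power
  of the characteristic, then yields a point outside orb that reaches S in two steps, the second
  of which is totally ramified; this ramification compensates for the extra step.

  If f is a polynomial, infinity is fixed and only the first return of 0 to itself matters; when 0
  is the only preimage of 0 at that time, f is a monomial or the same roots of unity
  force f = a X^(p^l) + b.
*)
theory Submission
  imports Defs "HOL-Algebra.Algebraic_Closure_Type"
begin

hide_const (open) Module.smult UnivPoly.coeff UnivPoly.monom Polynomials.degree
  Polynomials.lead_coeff Coset.order Divisibility.prime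

section \<open>Polynomials, homogenisation and common roots\<close>

lemma to_fract_power: "to_fract (x ^ n) = to_fract x ^ n"
  by (induction n) simp_all

definition ev :: "('a::field \<Rightarrow> 'b::comm_ring_1) \<Rightarrow> 'a poly \<Rightarrow> 'b \<Rightarrow> 'b" where
  "ev c q x = poly (map_poly c q) x"

text \<open>The binary form of degree \<open>d\<close> attached to \<open>q\<close>. The degree is a
  parameter, possibly above \<open>degree q\<close>, so that numerator and denominator are
  homogenised alike; an excess becomes a zero at infinity.\<close>

definition homog :: "('a::field \<Rightarrow> 'b::comm_ring_1) \<Rightarrow> nat \<Rightarrow> 'a poly \<Rightarrow> 'b \<Rightarrow> 'b \<Rightarrow> 'b" where
  "homog c d q u v = (\<Sum>i\<le>d. c (coeff q i) * u ^ i * v ^ (d - i))"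

locale coeff_hom =
  fixes c :: "'a::field \<Rightarrow> 'b::comm_ring_1"
  assumes c_add: "c (x + y) = c x + c y"
    and c_mult: "c (x * y) = c x * c y"
    and c_1: "c 1 = 1"
begin

lemma c_0: "c 0 = 0"
  using c_add[of 0 0] by simp

lemma c_eq_0_iff: "c x = 0 \<longleftrightarrow> x = 0"
proof
  assume "c x = 0"
  show "x = 0"
  proof (rule ccontr)
    assume "x \<noteq> 0"
    then have "c x * c (inverse x) = 1"
      by (simp add: c_1 flip: c_mult)
    with \<open>c x = 0\<close> show False by simp
  qed
qed (simp add: c_0)

lemma c_power: "c (x ^ n) = c x ^ n"
  by (induction n) (simp_all add: c_1 c_mult)

lemma ev_0: "ev c 0 x = 0"
  by (simp add: ev_def)

lemma ev_pCons: "ev c (pCons a q) x = c a + x * ev c q x"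
  by (simp add: ev_def map_poly_pCons c_0)

lemma ev_const: "ev c [:a:] x = c a"
  by (simp add: ev_pCons ev_0)

lemma ev_1: "ev c 1 x = 1"
  by (simp add: one_pCons ev_const c_1)

lemma ev_X: "ev c [:0, 1:] x = x"
  by (simp add: ev_pCons ev_0 c_0 c_1)

lemma ev_add: "ev c (p + q) x = ev c p x + ev c q x"
  by (induction p q rule: poly_induct2) (simp_all add: ev_pCons ev_0 c_add algebra_simps)

lemma ev_smult: "ev c (smult a q) x = c a * ev c q x"
  by (induction q) (simp_all add: ev_pCons ev_0 c_mult algebra_simps)

lemma ev_mult: "ev c (p * q) x = ev c p x * ev c q x"
  by (induction p) (simp_all add: ev_pCons ev_0 ev_add ev_smult c_0 algebra_simps)

lemma ev_diff: "ev c (p - q) x = ev c p x - ev c q x"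
  using ev_add[of "p - q" q x] by simp

lemma ev_power: "ev c (p ^ n) x = ev c p x ^ n"
  by (induction n) (simp_all add: ev_1 ev_mult)

lemma ev_sum: "ev c (\<Sum>i\<in>I. p i) x = (\<Sum>i\<in>I. ev c (p i) x)"
  by (induction I rule: infinite_finite_induct) (simp_all add: ev_0 ev_add)

lemma ev_dvd: "p dvd q \<Longrightarrow> ev c p x = 0 \<Longrightarrow> ev c q x = 0"
  by (auto simp: dvd_def ev_mult)

lemma ev_altdef: "ev c q x = (\<Sum>i\<le>degree q. c (coeff q i) * x ^ i)"
  using ev_sum[of "\<lambda>i. smult (coeff q i) ([:0, 1:] ^ i)" "{..degree q}" x]
        poly_as_sum_of_monoms[of q]
  by (simp add: monom_altdef ev_smult ev_power ev_X)

lemma homog_scale: "homog c d q (l * u) (l * v) = l ^ d * homog c d q u v"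
proof -
  have "c (coeff q i) * (l * u) ^ i * (l * v) ^ (d - i) = l ^ d * (c (coeff q i) * u ^ i * v ^ (d - i))"
    if "i \<le> d" for i
  proof -
    have "l ^ d = l ^ i * l ^ (d - i)"
      using that by (simp flip: power_add)
    then show ?thesis by (simp add: power_mult_distrib ac_simps)
  qed
  then show ?thesis
    by (simp add: homog_def sum_distrib_left)
qed

lemma homog_v0: "homog c d q u 0 = c (coeff q d) * u ^ d"
proof -
  have "homog c d q u 0 = (\<Sum>i\<in>{d}. c (coeff q i) * u ^ i * 0 ^ (d - i))"
    unfolding homog_def by (rule sum.mono_neutral_right) (auto simp: power_0_left split: if_splits)
  then show ?thesis by simp
qed

lemma homog_v1: "degree q \<le> d \<Longrightarrow> homog c d q u 1 = ev c q u"
  unfolding homog_def ev_altdef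
  by (simp, rule sum.mono_neutral_right) (auto simp: coeff_eq_0 c_0)

end

locale coeff_hom_field = coeff_hom c for c :: "'a::field \<Rightarrow> 'b::field"
begin

lemma c_divide: "c (x / y) = c x / c y"
proof (cases "y = 0")
  case False
  then have "c (x / y) * c y = c x" by (simp flip: c_mult)
  then show ?thesis using False by (simp add: c_eq_0_iff field_simps)
qed (simp add: c_0)

lemma homog_eq_ev:
  assumes "degree q \<le> d" "v \<noteq> 0"
  shows "homog c d q u v = v ^ d * ev c q (u / v)"
  using homog_scale[of d q v "u / v" 1] homog_v1[OF assms(1)] assms(2) by simp

end

lemma homog_map:
  assumes "\<And>x y. \<psi> (x + y) = \<psi> x + \<psi> y" "\<And>x y. \<psi> (x * y) = \<psi> x * \<psi> y" "\<psi> 1 = 1" "\<psi> 0 = 0"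
  shows "\<psi> (homog c d q u v) = homog (\<lambda>a. \<psi> (c a)) d q (\<psi> u) (\<psi> v)"
proof -
  have pow: "\<psi> (x ^ n) = \<psi> x ^ n" for x n
    by (induction n) (simp_all add: assms)
  have "\<psi> (\<Sum>i\<in>I. F i) = (\<Sum>i\<in>I. \<psi> (F i))" for I :: "nat set" and F
    by (induction I rule: infinite_finite_induct) (simp_all add: assms)
  then show ?thesis
    by (simp add: homog_def assms pow)
qed

interpretation ac: coeff_hom_field "to_ac :: 'a::field \<Rightarrow> 'a alg_closure"
  by unfold_locales simp_all

interpretation rfc: coeff_hom_field "rf_const :: 'a::field \<Rightarrow> 'a ratfun"
  by unfold_locales (simp_all add: rf_const_def flip: to_fract_add to_fract_mult one_pCons)

abbreviation phomog :: "nat \<Rightarrow> 'a::field poly \<Rightarrow> 'a poly \<Rightarrow> 'a poly \<Rightarrow> 'a poly" where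
  "phomog \<equiv> homog (\<lambda>a. [:a:])"

lemma to_fract_phomog: "to_fract (phomog d q U V) = homog rf_const d q (to_fract U) (to_fract V)"
  by (subst homog_map[where \<psi> = to_fract]) (simp_all add: rf_const_def[abs_def])

lemma ev_phomog: "ev to_ac (phomog d q U V) x = homog to_ac d q (ev to_ac U x) (ev to_ac V x)"
  by (subst homog_map[where \<psi> = "\<lambda>p. ev to_ac p x"])
    (simp_all add: ac.ev_add ac.ev_mult ac.ev_1 ac.ev_0 ac.ev_const)

lemma ev_rf_const_phomog: "ev rf_const (phomog d q U V) x = homog rf_const d q (ev rf_const U x) (ev rf_const V x)"
  by (subst homog_map[where \<psi> = "\<lambda>p. ev rf_const p x"])
    (simp_all add: rfc.ev_add rfc.ev_mult rfc.ev_1 rfc.ev_0 rfc.ev_const)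

lemma degree_phomog:
  assumes "degree U \<le> m" "degree V \<le> m"
  shows "degree (phomog d q U V) \<le> d * m"
  unfolding homog_def
proof (rule degree_sum_le)
  fix i assume "i \<in> {..d}"
  have "degree ([:coeff q i:] * U ^ i * V ^ (d - i)) \<le> degree (U ^ i) + degree (V ^ (d - i))"
    using degree_mult_le[of "U ^ i" "V ^ (d - i)"] degree_smult_le[of "coeff q i" "U ^ i * V ^ (d - i)"]
    by simp
  also have "\<dots> \<le> m * i + m * (d - i)"
    by (meson add_mono assms degree_power_le le_trans mult_le_mono1)
  also have "\<dots> = d * m"
    using \<open>i \<in> {..d}\<close> by (metis add_mult_distrib2 atMost_iff le_add_diff_inverse mult.commute)
  finally show "degree ([:coeff q i:] * U ^ i * V ^ (d - i)) \<le> d * m" .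
qed simp

lemma coeff_mult_top:
  fixes p q :: "'a::comm_semiring_0 poly"
  assumes "degree p \<le> m" "degree q \<le> n"
  shows "coeff (p * q) (m + n) = coeff p m * coeff q n"
proof (cases "degree p = m \<and> degree q = n")
  case False
  then have "degree p < m \<or> degree q < n"
    using assms by auto
  then have "degree p + degree q < m + n"
    using assms by auto
  then have "coeff (p * q) (m + n) = 0"
    by (meson coeff_eq_0 degree_mult_le order_le_less_trans)
  with \<open>degree p < m \<or> degree q < n\<close> show ?thesis
    by (auto simp: coeff_eq_0)
qed (auto simp: coeff_mult_degree_sum)

lemma coeff_power_top:
  fixes p :: "'a::comm_semiring_1 poly"
  assumes "degree p \<le> m"
  shows "coeff (p ^ n) (m * n) = coeff p m ^ n"
proof (induction n)
  case (Suc n)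
  have "degree (p ^ n) \<le> m * n"
    using degree_power_le[of p n] assms by (meson le_trans mult_le_mono1)
  from coeff_mult_top[OF assms this] Suc show ?case by simp
qed simp

text \<open>The coefficients in degree \<open>m\<close> are the homogeneous coordinates of the image
  of infinity, so this is the counterpart of \<open>ev_phomog\<close> at infinity.\<close>

lemma coeff_phomog:
  assumes "degree U \<le> m" "degree V \<le> m"
  shows "to_ac (coeff (phomog d q U V) (d * m)) = homog to_ac d q (to_ac (coeff U m)) (to_ac (coeff V m))"
proof -
  have "coeff ([:coeff q i:] * U ^ i * V ^ (d - i)) (d * m) = coeff q i * coeff U m ^ i * coeff V m ^ (d - i)"
    if "i \<le> d" for i
  proof -
    have dm: "d * m = m * i + m * (d - i)"
      using that by (metis add_mult_distrib2 le_add_diff_inverse mult.commute)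
    have "degree (U ^ i) \<le> m * i" "degree (V ^ (d - i)) \<le> m * (d - i)"
      by (meson assms degree_power_le le_trans mult_le_mono1)+
    from coeff_mult_top[OF this] show ?thesis
      unfolding dm by (simp add: coeff_power_top assms)
  qed
  then have "coeff (phomog d q U V) (d * m) = (\<Sum>i\<le>d. coeff q i * coeff U m ^ i * coeff V m ^ (d - i))"
    unfolding homog_def coeff_sum by (intro sum.cong) auto
  then show ?thesis
    by (simp add: homog_def to_ac_sum)
qed

text \<open>The composition law for forms. In the fraction field a form at \<open>(U, V)\<close> is
  a power of \<open>V\<close> times an evaluation at \<open>U / V\<close>, which is where
  \<open>V \<noteq> 0\<close> enters.\<close>

lemma phomog_phomog:
  assumes V: "V \<noteq> 0" and d: "degree A \<le> m" "degree B \<le> m"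
  shows "phomog d q (phomog m A U V) (phomog m B U V) = phomog (d * m) (phomog d q A B) U V"
proof -
  let ?u = "to_fract U" and ?v = "to_fract V"
  have "to_fract (phomog d q (phomog m A U V) (phomog m B U V))
      = homog rf_const d q (?v ^ m * ev rf_const A (?u / ?v)) (?v ^ m * ev rf_const B (?u / ?v))"
    using V d by (simp add: to_fract_phomog rfc.homog_eq_ev)
  also have "\<dots> = ?v ^ (d * m) * ev rf_const (phomog d q A B) (?u / ?v)"
    by (simp add: rfc.homog_scale ev_rf_const_phomog mult.commute flip: power_mult)
  also have "\<dots> = to_fract (phomog (d * m) (phomog d q A B) U V)"
    using V d by (simp add: to_fract_phomog rfc.homog_eq_ev degree_phomog)
  finally show ?thesis by simp
qed

text \<open>Homogenisation is multiplicative when degrees add up; the excess of \<open>m\<close>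
  over \<open>M * degree Q\<close> goes into the form of the cofactor \<open>T\<close>.\<close>

lemma phomog_dvd:
  assumes V: "V \<noteq> 0" and R: "R \<noteq> 0" "degree R \<le> m" and Q: "Q ^ M dvd R"
  shows "phomog (degree Q) Q U V ^ M dvd phomog m R U V"
proof -
  let ?u = "to_fract U" and ?v = "to_fract V"
  obtain T where T: "R = Q ^ M * T" using Q by blast
  have "Q ^ M \<noteq> 0" and T0: "T \<noteq> 0" using R T by auto
  then have "degree R = degree (Q ^ M) + degree T" using T by (simp add: degree_mult_eq)
  moreover have "degree (Q ^ M) = M * degree Q"
    by (cases "Q = 0") (use \<open>Q ^ M \<noteq> 0\<close> in \<open>auto simp: degree_power_eq\<close>)
  ultimately have m: "m = M * degree Q + (m - M * degree Q)" "degree T \<le> m - M * degree Q"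
    using R by auto
  have "to_fract (phomog m R U V) = ?v ^ m * ev rf_const R (?u / ?v)"
    using V R by (simp add: to_fract_phomog rfc.homog_eq_ev)
  also have "\<dots> = (?v ^ degree Q * ev rf_const Q (?u / ?v)) ^ M * (?v ^ (m - M * degree Q) * ev rf_const T (?u / ?v))"
    by (subst m(1)) (simp add: T rfc.ev_mult rfc.ev_power power_add power_mult_distrib ac_simps flip: power_mult)
  also have "\<dots> = to_fract (phomog (degree Q) Q U V ^ M * phomog (m - M * degree Q) T U V)"
    using V m by (simp add: to_fract_phomog rfc.homog_eq_ev to_fract_power)
  finally show ?thesis
    by (metis dvd_triv_left to_fract_eq_iff)
qed

section \<open>Roots in the algebraic closure, minimal polynomials and coprimality\<close>

lemma ev_to_ac: "ev to_ac q (to_ac s) = to_ac (poly q s)"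
  by (induction q) (simp_all add: ac.ev_0 ac.ev_pCons)

lemma ac_root_exists:
  assumes "degree (q :: 'a::field poly) > 0"
  shows "\<exists>x. ev to_ac q x = 0"
proof -
  have "degree (map_poly to_ac q) = degree q"
    using assms by (intro map_poly_degree_eq) auto
  then show ?thesis
    unfolding ev_def using assms by (intro alg_closed_imp_poly_has_root) simp
qed

text \<open>The last property says that the only possible rational conjugate of \<open>y\<close> is
  \<open>y\<close> itself: a rational root splits off a linear factor, and by minimality the
  cofactor does not vanish at \<open>y\<close>.\<close>

lemma minimal_polynomial:
  fixes R :: "'a::field poly"
  assumes "R \<noteq> 0" "ev to_ac R y = 0"
  obtains Q where "degree Q > 0" "\<And>P. ev to_ac P y = 0 \<Longrightarrow> Q dvd P"
    "\<And>s. ev to_ac Q (to_ac s) = 0 \<Longrightarrow> y = to_ac s"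
proof -
  define n where "n = (LEAST n. \<exists>Q. Q \<noteq> 0 \<and> ev to_ac Q y = 0 \<and> degree Q = n)"
  have "\<exists>Q. Q \<noteq> 0 \<and> ev to_ac Q y = 0 \<and> degree Q = n"
    unfolding n_def by (rule LeastI[of _ "degree R"]) (use assms in auto)
  then obtain Q where Q: "Q \<noteq> 0" "ev to_ac Q y = 0" "degree Q = n" by blast
  have min: "n \<le> degree P" if "P \<noteq> 0" "ev to_ac P y = 0" for P
    unfolding n_def by (rule Least_le) (use that in auto)
  have pos: "degree Q > 0"
  proof (rule ccontr)
    assume "\<not> degree Q > 0"
    then obtain a where "Q = [:a:]" using degree_eq_zeroE by auto
    with Q show False by (simp add: ac.ev_const)
  qed
  have dvd: "Q dvd P" if "ev to_ac P y = 0" for P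
  proof -
    have "P = P div Q * Q + P mod Q" by simp
    then have "ev to_ac (P mod Q) y = 0"
      using that Q by (metis ac.ev_add ac.ev_mult add_0 mult_zero_right)
    then have "P mod Q = 0"
      using min[of "P mod Q"] degree_mod_less[of Q P] Q by (metis linorder_not_less)
    then show ?thesis by (simp add: mod_eq_0_iff_dvd)
  qed
  have "y = to_ac s" if "ev to_ac Q (to_ac s) = 0" for s
  proof -
    have "poly Q s = 0" using that by (simp add: ev_to_ac)
    then obtain T where T: "Q = [:-s, 1:] * T" by (auto simp: poly_eq_0_iff_dvd)
    then have "T \<noteq> 0" "degree Q = Suc (degree T)"
      using Q by (auto simp: degree_mult_eq simp del: mult_pCons_left)
    then have "ev to_ac T y \<noteq> 0" using min[of T] Q by auto
    then have "ev to_ac [:-s, 1:] y = 0"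
      using Q T by (simp add: ac.ev_mult del: mult_pCons_left)
    then show ?thesis by (simp add: ac.ev_pCons ac.ev_0)
  qed
  with pos dvd that show thesis by blast
qed

lemma poly_bezout:
  fixes A B :: "'a::field poly"
  shows "\<exists>D U V. D = U * A + V * B \<and> D dvd A \<and> D dvd B"
proof (induction "euclidean_size B" arbitrary: A B rule: less_induct)
  case less
  show ?case
  proof (cases "B = 0")
    case True
    then show ?thesis by (intro exI[of _ A] exI[of _ 1] exI[of _ 0]) simp
  next
    case False
    from less[OF mod_size_less[OF False], of B A] obtain D U V
      where D: "D = U * B + V * (A mod B)" "D dvd B" "D dvd A mod B" by blast
    have "D dvd A" using D by (metis dvd_mod_iff)
    moreover have "D = V * A + (U - V * (A div B)) * B"
      unfolding D(1) by (simp add: algebra_simps minus_div_mult_eq_mod[symmetric])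
    ultimately show ?thesis using D by blast
  qed
qed

text \<open>Coprimality phrased through points of the closure, so that it can be read off from the
  dynamics of the induced map.\<close>

definition no_common_root :: "'a::field poly \<Rightarrow> 'a poly \<Rightarrow> bool" where
  "no_common_root A B \<longleftrightarrow> (\<forall>x. ev to_ac A x = 0 \<longrightarrow> ev to_ac B x \<noteq> 0)"

text \<open>Every root of a common divisor is a common root, so the divisor \<open>D\<close> is
  constant and can be scaled to 1.\<close>

lemma no_common_root_bezout:
  assumes "no_common_root A B" "A \<noteq> 0 \<or> B \<noteq> 0"
  obtains U V where "U * A + V * B = 1"
proof -
  obtain D U V where D: "D = U * A + V * B" "D dvd A" "D dvd B"
    using poly_bezout by blast
  have "D \<noteq> 0" using D assms by auto
  moreover have "degree D = 0"
    using ac_root_exists[of D] D assms ac.ev_dvd by (fastforce simp: no_common_root_def)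
  ultimately obtain a where a: "D = [:a:]" "a \<noteq> 0" by (metis degree_eq_zeroE pCons_0_0)
  then have "smult (inverse a) D = 1" by (simp add: one_pCons)
  then have "smult (inverse a) U * A + smult (inverse a) V * B = 1"
    using D(1) by (simp add: smult_add_right)
  with that show thesis by blast
qed

text \<open>The minimal polynomial of a common root is a nonconstant common divisor; conversely a
  Bezout identity leaves only units.\<close>

lemma coprime_iff_no_common_root:
  fixes A B :: "'a::field poly"
  assumes "A \<noteq> 0 \<or> B \<noteq> 0"
  shows "coprime A B \<longleftrightarrow> no_common_root A B"
proof
  assume cop: "coprime A B"
  show "no_common_root A B"
    unfolding no_common_root_def
  proof (intro allI impI notI)
    fix x assume x: "ev to_ac A x = 0" "ev to_ac B x = 0"
    obtain Q where Q: "degree Q > 0" "Q dvd A" "Q dvd B"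
    proof (cases "A = 0")
      case True
      with assms x show ?thesis by (metis minimal_polynomial that)
    next
      case False
      with x show ?thesis by (metis minimal_polynomial that)
    qed
    then have "is_unit Q" using cop coprime_common_divisor by blast
    moreover have "Q \<noteq> 0" using Q(1) by auto
    ultimately show False using Q(1) is_unit_iff_degree[of Q] by simp
  qed
next
  assume "no_common_root A B"
  then obtain U V where "U * A + V * B = 1" using no_common_root_bezout assms by blast
  then show "coprime A B"
    by (metis coprimeI dvd_add dvd_mult)
qed

text \<open>Euclid's lemma, by multiplying a Bezout identity by \<open>R\<close>.\<close>

lemma no_common_root_dvd_mult:
  assumes "no_common_root A B" "A \<noteq> 0" "A dvd R * B"
  shows "A dvd R"
proof -
  obtain U V where "U * A + V * B = 1" by (rule no_common_root_bezout[OF assms(1)]) (use assms(2) in auto)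
  then have "(U * A + V * B) * R = R" by simp
  then have "A * (U * R) + V * (R * B) = R" by (simp add: algebra_simps)
  moreover have "A dvd A * (U * R) + V * (R * B)"
    by (rule dvd_add[OF dvd_triv_left dvd_mult[OF assms(3)]])
  ultimately show ?thesis by simp
qed

section \<open>Rational functions and their action on the projective line\<close>

lemma rf_quot_exists:
  fixes f :: "'a::field ratfun"
  shows "\<exists>N D. f = to_fract N / to_fract D \<and> coprime N D \<and> lead_coeff D = 1"
proof -
  \<comment> \<open>A denominator of least degree gives lowest terms, since a nonconstant common
    factor could be cancelled. Scaling then makes it monic.\<close>
  define P where "P n \<longleftrightarrow> (\<exists>N D. f = to_fract N / to_fract D \<and> D \<noteq> 0 \<and> degree D = n)" for n
  obtain N0 D0 where "f = Fract N0 D0" "D0 \<noteq> 0" by (cases f)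
  then have "P (degree D0)" by (auto simp: P_def Fract_conv_to_fract)
  then have "P (LEAST n. P n)" by (rule LeastI)
  then obtain N D where ND: "f = to_fract N / to_fract D" "D \<noteq> 0" "degree D = (LEAST n. P n)"
    by (auto simp: P_def)
  have "coprime N D"
  proof (rule coprimeI)
    fix E assume "E dvd N" "E dvd D"
    then obtain N' D' where E: "N = E * N'" "D = E * D'" by (auto simp: dvd_def)
    with ND have "E \<noteq> 0" "D' \<noteq> 0" by auto
    then have "f = to_fract N' / to_fract D'" using ND E by simp
    with \<open>D' \<noteq> 0\<close> have "P (degree D')" by (auto simp: P_def)
    then have "degree D \<le> degree D'" using ND by (simp add: Least_le)
    then have "degree E = 0" using E \<open>E \<noteq> 0\<close> \<open>D' \<noteq> 0\<close> by (simp add: degree_mult_eq)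
    then show "is_unit E" using \<open>E \<noteq> 0\<close> by (simp add: is_unit_iff_degree)
  qed
  define a where "a = inverse (lead_coeff D)"
  have a: "a \<noteq> 0" using ND(2) by (simp add: a_def)
  have "to_fract (smult a R) = to_fract [:a:] * to_fract R" for R
    by (simp flip: to_fract_mult)
  then have "f = to_fract (smult a N) / to_fract (smult a D)"
    using ND(1) a by simp
  moreover have "coprime (smult a N) (smult a D)"
    using \<open>coprime N D\<close> a by (auto simp: coprime_def dvd_smult_iff)
  moreover have "lead_coeff (smult a D) = 1"
    using ND(2) by (simp add: a_def)
  ultimately show ?thesis by blast
qed

lemma rf_num_den:
  fixes f :: "'a::field ratfun"
  shows "f = to_fract (rf_num f) / to_fract (rf_den f)" "coprime (rf_num f) (rf_den f)"
    "lead_coeff (rf_den f) = 1" "rf_den f \<noteq> 0" "no_common_root (rf_num f) (rf_den f)"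
proof -
  let ?P = "\<lambda>x. case x of (g, h) \<Rightarrow> f = to_fract g / to_fract h \<and> coprime g h \<and> lead_coeff h = 1"
  have "?P (rf_quot f)"
    unfolding rf_quot_def using rf_quot_exists[of f] by (intro someI_ex[of ?P]) auto
  then show 1: "f = to_fract (rf_num f) / to_fract (rf_den f)" "coprime (rf_num f) (rf_den f)"
    "lead_coeff (rf_den f) = 1"
    by (auto simp: rf_num_def rf_den_def)
  then show 2: "rf_den f \<noteq> 0" by auto
  show "no_common_root (rf_num f) (rf_den f)" using 1 2 coprime_iff_no_common_root by blast
qed

lemma rf_num_den_unique:
  fixes N D :: "'a::field poly"
  assumes f: "f = to_fract N / to_fract D" "D \<noteq> 0" "no_common_root N D"
  obtains a where "a \<noteq> 0" "rf_num f = smult a N" "rf_den f = smult a D"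
proof -
  note nd = rf_num_den[of f]
  have eq: "rf_num f * D = N * rf_den f"
  proof -
    have "to_fract (rf_num f) / to_fract (rf_den f) = to_fract N / to_fract D"
      by (rule trans[OF nd(1)[symmetric] f(1)])
    then have "to_fract (rf_num f * D) = to_fract (N * rf_den f)"
      using nd(4) f(2) by (simp add: frac_eq_eq)
    then show ?thesis by (simp only: to_fract_eq_iff)
  qed
  have "D dvd rf_den f"
  proof (rule no_common_root_dvd_mult)
    show "no_common_root D N" using f by (auto simp: no_common_root_def)
    show "D dvd rf_den f * N" using eq by (metis dvd_triv_right mult.commute)
  qed fact
  moreover have "rf_den f dvd D"
  proof (rule no_common_root_dvd_mult)
    show "no_common_root (rf_den f) (rf_num f)" using nd by (auto simp: no_common_root_def)
    show "rf_den f dvd D * rf_num f" using eq by (metis dvd_triv_right mult.commute)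
  qed (rule nd)
  ultimately obtain E where E: "rf_den f = D * E" "degree (rf_den f) = degree D"
    using f nd by (metis dvd_def dvd_imp_degree_le dual_order.antisym)
  then have "E \<noteq> 0" "degree E = 0" using nd f by (auto simp: degree_mult_eq)
  then obtain a where a: "E = [:a:]" "a \<noteq> 0" by (metis degree_eq_zeroE pCons_0_0)
  have "rf_num f * D = (N * E) * D" using eq E by (simp add: ac_simps)
  then have "rf_num f = N * E" using f by simp
  with a E that show thesis by simp
qed

lemma rf_deg_quot:
  assumes "f = to_fract N / to_fract D" "D \<noteq> 0" "no_common_root N D"
  shows "rf_deg f = max (degree N) (degree D)"
  using rf_num_den_unique[OF assms] by (metis degree_smult_eq rf_deg_def)

lemma rf_comp_quot:
  assumes "f = to_fract N / to_fract D" "D \<noteq> 0" "no_common_root N D"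
  shows "rf_comp f u = poly_at_rf N u / poly_at_rf D u"
proof -
  obtain a where a: "a \<noteq> 0" "rf_num f = smult a N" "rf_den f = smult a D"
    using rf_num_den_unique[OF assms] .
  then have "rf_const a \<noteq> 0" by (simp add: rfc.c_eq_0_iff)
  with a show ?thesis
    by (simp add: rf_comp_def poly_at_rf_def flip: ev_def) (simp add: rfc.ev_smult)
qed

text \<open>The point \<open>(u : v)\<close> of the projective line, with \<open>None\<close> as infinity; \<open>pt 0 0\<close> is junk.\<close>

definition pt :: "'k::field \<Rightarrow> 'k \<Rightarrow> 'k option" where
  "pt u v = (if v = 0 then None else Some (u / v))"

lemma pt_scale: "l \<noteq> 0 \<Longrightarrow> pt (l * u) (l * v) = pt u v"
  by (simp add: pt_def)

lemma pt_eq_None_iff: "pt u v = None \<longleftrightarrow> v = 0"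
  by (simp add: pt_def)

lemma pt_eq_0_iff: "u \<noteq> 0 \<or> v \<noteq> 0 \<Longrightarrow> pt u v = Some 0 \<longleftrightarrow> u = 0"
  by (auto simp: pt_def)

section \<open>The induced map on the projective line and the iterates\<close>

locale ratmap =
  fixes f :: "'a::field ratfun"
  assumes deg_pos: "rf_deg f \<ge> 1"
begin

abbreviation "g \<equiv> rf_num f"
abbreviation "h \<equiv> rf_den f"
abbreviation "d \<equiv> rf_deg f"

lemma degree_g_le: "degree g \<le> d" and degree_h_le: "degree h \<le> d"
  by (simp_all add: rf_deg_def)

lemma coeff_d: "coeff g d \<noteq> 0 \<or> coeff h d \<noteq> 0"
  using deg_pos by (metis leading_coeff_0_iff max_def rf_deg_def degree_0 rf_num_den(4) not_one_le_zero)

lemma ev_gh: "ev to_ac g x \<noteq> 0 \<or> ev to_ac h x \<noteq> 0"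
  using rf_num_den(5)[of f] by (auto simp: no_common_root_def)

text \<open>At finite points this is the fraction being in lowest terms; at infinity it is that one
  of \<open>g\<close>, \<open>h\<close> has degree exactly \<open>d\<close>. Hence
  \<open>act\<close> can be computed in homogeneous coordinates.\<close>

lemma homog_gh:
  assumes "u \<noteq> 0 \<or> v \<noteq> 0"
  shows "homog to_ac d g u v \<noteq> 0 \<or> homog to_ac d h u v \<noteq> 0"
proof (cases "v = 0")
  case True
  then show ?thesis using assms coeff_d by (simp add: ac.homog_v0)
next
  case False
  then show ?thesis
    using ev_gh[of "u / v"] degree_g_le degree_h_le by (simp add: ac.homog_eq_ev)
qed

definition act :: "'a alg_closure option \<Rightarrow> 'a alg_closure option" where
  "act z = (case z of None \<Rightarrow> pt (to_ac (coeff g d)) (to_ac (coeff h d))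
              | Some x \<Rightarrow> pt (ev to_ac g x) (ev to_ac h x))"

lemma act_None: "act None = pt (to_ac (coeff g d)) (to_ac (coeff h d))"
  and act_Some: "act (Some x) = pt (ev to_ac g x) (ev to_ac h x)"
  by (simp_all add: act_def)

lemma act_pt:
  assumes "u \<noteq> 0 \<or> v \<noteq> 0"
  shows "act (pt u v) = pt (homog to_ac d g u v) (homog to_ac d h u v)"
proof (cases "v = 0")
  case True
  then have "pt (homog to_ac d g u v) (homog to_ac d h u v)
      = pt (u ^ d * to_ac (coeff g d)) (u ^ d * to_ac (coeff h d))"
    by (simp add: ac.homog_v0 mult.commute)
  also have "\<dots> = pt (to_ac (coeff g d)) (to_ac (coeff h d))"
    using True assms by (intro pt_scale) simp
  finally show ?thesis using True by (simp add: pt_def[of u] act_None)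
next
  case False
  then show ?thesis
    using degree_g_le degree_h_le by (simp add: ac.homog_eq_ev pt_scale pt_def[of u] act_Some)
qed

text \<open>Homogeneous substitution with fixed \<open>d\<close> yields each iterate as a fraction
  of polynomials. Nothing ever cancels, as \<open>ev_num_den\<close> shows at finite points and
  \<open>top_num_den\<close> at infinity.\<close>

primrec nd :: "nat \<Rightarrow> 'a poly \<times> 'a poly" where
  "nd 0 = ([:0, 1:], 1)"
| "nd (Suc k) = (phomog d g (fst (nd k)) (snd (nd k)), phomog d h (fst (nd k)) (snd (nd k)))"

definition "num k = fst (nd k)"
definition "den k = snd (nd k)"

lemma num_den_0: "num 0 = [:0, 1:]" "den 0 = 1"
  by (simp_all add: num_def den_def)

lemma num_den_Suc: "num (Suc k) = phomog d g (num k) (den k)" "den (Suc k) = phomog d h (num k) (den k)"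
  by (simp_all add: num_def den_def)

text \<open>The two claims go together because \<open>act_pt\<close> needs coordinates that are not
  both zero.\<close>

lemma ev_num_den:
  "(ev to_ac (num k) x \<noteq> 0 \<or> ev to_ac (den k) x \<noteq> 0) \<and>
   (act ^^ k) (Some x) = pt (ev to_ac (num k) x) (ev to_ac (den k) x)"
proof (induction k)
  case 0
  show ?case by (simp add: num_den_0 ac.ev_1 ac.ev_X pt_def)
next
  case (Suc k)
  with homog_gh[of "ev to_ac (num k) x" "ev to_ac (den k) x"] show ?case
    by (simp add: num_den_Suc ev_phomog act_pt)
qed

lemma top_num_den:
  "degree (num k) \<le> d ^ k \<and> degree (den k) \<le> d ^ k \<and>
   (to_ac (coeff (num k) (d ^ k)) \<noteq> 0 \<or> to_ac (coeff (den k) (d ^ k)) \<noteq> 0) \<and>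
   (act ^^ k) None = pt (to_ac (coeff (num k) (d ^ k))) (to_ac (coeff (den k) (d ^ k)))"
proof (induction k)
  case 0
  show ?case by (simp add: num_den_0 pt_def)
next
  case (Suc k)
  then have deg: "degree (num k) \<le> d ^ k" "degree (den k) \<le> d ^ k" by auto
  from Suc homog_gh[of "to_ac (coeff (num k) (d ^ k))" "to_ac (coeff (den k) (d ^ k))"] show ?case
    unfolding num_den_Suc power_Suc coeff_phomog[OF deg] funpow.simps
    by (simp add: degree_phomog act_pt del: to_ac_eq_0_iff)
qed

lemma degree_num_le: "degree (num k) \<le> d ^ k" and degree_den_le: "degree (den k) \<le> d ^ k"
  using top_num_den by auto

lemma degree_num_or_den: "degree (num k) = d ^ k \<or> degree (den k) = d ^ k"
  using top_num_den[of k] le_degree by (metis antisym to_ac_0)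

lemma num_root_iff: "ev to_ac (num k) x = 0 \<longleftrightarrow> (act ^^ k) (Some x) = Some 0"
  and den_root_iff: "ev to_ac (den k) x = 0 \<longleftrightarrow> (act ^^ k) (Some x) = None"
  using ev_num_den[of k x] by (auto simp: pt_eq_0_iff pt_eq_None_iff)

lemma num_nz: "num k \<noteq> 0" and den_nz: "den k \<noteq> 0"
proof -
  have pos: "d ^ k > 0" using deg_pos by simp
  show "num k \<noteq> 0"
  proof
    assume "num k = 0"
    then have "degree (den k) > 0" using degree_num_or_den[of k] pos by auto
    with \<open>num k = 0\<close> show False using ac_root_exists ev_num_den ac.ev_0 by metis
  qed
  show "den k \<noteq> 0"
  proof
    assume "den k = 0"
    then have "degree (num k) > 0" using degree_num_or_den[of k] pos by auto
    with \<open>den k = 0\<close> show False using ac_root_exists ev_num_den ac.ev_0 by metis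
  qed
qed

text \<open>This splitting lets a factor of \<open>num s\<close> or \<open>den s\<close> be pulled
  back along the first \<open>k\<close> steps.\<close>

lemma num_den_add:
  "num (s + k) = phomog (d ^ s) (num s) (num k) (den k) \<and>
   den (s + k) = phomog (d ^ s) (den s) (num k) (den k)"
proof (induction s)
  case 0
  have "{..Suc 0} = {0, 1}" by auto
  then show ?case by (simp add: num_den_0 homog_def)
next
  case (Suc s)
  then show ?case
    by (simp add: num_den_Suc phomog_phomog den_nz degree_num_le degree_den_le)
qed

lemma rf_iter_eq: "rf_iter k f = to_fract (num k) / to_fract (den k)"
proof (induction k)
  case 0
  show ?case by (simp add: num_den_0 rf_X_def)
next
  case (Suc k)
  let ?v = "to_fract (den k)"
  have "rf_comp f (to_fract (num k) / ?v) = homog rf_const d g (to_fract (num k)) ?v / homog rf_const d h (to_fract (num k)) ?v"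
    using den_nz degree_g_le degree_h_le
    by (simp add: rf_comp_def poly_at_rf_def rfc.homog_eq_ev flip: ev_def)
  with Suc show ?case by (simp add: num_den_Suc to_fract_phomog)
qed

section \<open>Factors that survive in products of powers of iterates\<close>

lemma no_common_root_num_den: "no_common_root (num k) (den k)"
  using ev_num_den by (auto simp: no_common_root_def)

text \<open>By Euclid's lemma: \<open>N\<close> divides one side of the factor of index
  \<open>n\<close>, and the opposite side of the whole product shares no root with it, so
  \<open>N\<close> divides the reduced numerator or denominator.\<close>

lemma degree_prod_ge:
  assumes N: "N \<noteq> 0" "N dvd num n \<or> N dvd den n"
    and cop: "\<And>m. 1 \<le> m \<Longrightarrow> m < n \<Longrightarrow> no_common_root N (num m) \<and> no_common_root N (den m)"
    and n: "n \<ge> 1" and k: "k n \<noteq> 0"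
  shows "degree N \<le> rf_deg (\<Prod>i\<in>{1..n}. rf_iter i f powi k i)"
proof -
  \<comment> \<open>A negative exponent exchanges numerator and denominator. The first implication
    serves the indices below \<open>n\<close>, the second the index \<open>n\<close> itself.\<close>
  have pw: "\<exists>A B. A \<noteq> 0 \<and> B \<noteq> 0 \<and> rf_iter i f powi j = to_fract A / to_fract B \<and>
      (\<forall>R. (no_common_root R (num i) \<longrightarrow> no_common_root R (den i) \<longrightarrow> no_common_root R A \<and> no_common_root R B)) \<and>
      (j \<noteq> 0 \<longrightarrow> N dvd num i \<or> N dvd den i \<longrightarrow> N dvd A \<and> no_common_root N B \<or> N dvd B \<and> no_common_root N A)"
    for i and j :: int
  proof -
    define K where "K = nat \<bar>j\<bar>"
    have dvd: "N dvd x ^ K" if "N dvd x" "j \<noteq> 0" for x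
      using that by (simp add: K_def dvd_power_le dvd_trans[OF that(1)])
    have cpow: "no_common_root R x \<Longrightarrow> no_common_root R (x ^ K)" for R x
      by (simp add: no_common_root_def ac.ev_power)
    have *: "N dvd num i \<Longrightarrow> no_common_root N (den i)" "N dvd den i \<Longrightarrow> no_common_root N (num i)"
      using no_common_root_num_den[of i] ac.ev_dvd unfolding no_common_root_def by metis+
    show ?thesis
    proof (cases "j \<ge> 0")
      case True
      then have "nat j = K" by (simp add: K_def)
      with True have "rf_iter i f powi j = to_fract (num i ^ K) / to_fract (den i ^ K)"
        by (simp only: power_int_def rf_iter_eq to_fract_power power_divide if_True)
      moreover have "num i ^ K \<noteq> 0" "den i ^ K \<noteq> 0" using num_nz den_nz by simp_all
      moreover have "\<forall>R. no_common_root R (num i) \<longrightarrow> no_common_root R (den i) \<longrightarrow>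
          no_common_root R (num i ^ K) \<and> no_common_root R (den i ^ K)"
        by (simp add: cpow)
      moreover have "j \<noteq> 0 \<longrightarrow> N dvd num i \<or> N dvd den i \<longrightarrow>
          N dvd num i ^ K \<and> no_common_root N (den i ^ K) \<or> N dvd den i ^ K \<and> no_common_root N (num i ^ K)"
        using * dvd cpow by blast
      ultimately show ?thesis by blast
    next
      case False
      then have "nat (- j) = K" by (simp add: K_def)
      with False have "rf_iter i f powi j = to_fract (den i ^ K) / to_fract (num i ^ K)"
        by (simp only: power_int_def rf_iter_eq to_fract_power power_divide if_False inverse_divide)
      moreover have "den i ^ K \<noteq> 0" "num i ^ K \<noteq> 0" using num_nz den_nz by simp_all
      moreover have "\<forall>R. no_common_root R (num i) \<longrightarrow> no_common_root R (den i) \<longrightarrow>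
          no_common_root R (den i ^ K) \<and> no_common_root R (num i ^ K)"
        by (simp add: cpow)
      moreover have "j \<noteq> 0 \<longrightarrow> N dvd num i \<or> N dvd den i \<longrightarrow>
          N dvd den i ^ K \<and> no_common_root N (num i ^ K) \<or> N dvd num i ^ K \<and> no_common_root N (den i ^ K)"
        using * dvd cpow by blast
      ultimately show ?thesis by blast
    qed
  qed
  have rest: "\<exists>A B. A \<noteq> 0 \<and> B \<noteq> 0 \<and> (\<Prod>i\<in>I. rf_iter i f powi k i) = to_fract A / to_fract B \<and>
      no_common_root N A \<and> no_common_root N B" if "finite I" "I \<subseteq> {1..<n}" for I
    using that
  proof (induction I rule: finite_induct)
    case empty
    show ?case by (intro exI[of _ 1]) (simp add: no_common_root_def ac.ev_1)
  next
    case (insert i I)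
    then obtain A B where AB: "A \<noteq> 0" "B \<noteq> 0" "(\<Prod>i\<in>I. rf_iter i f powi k i) = to_fract A / to_fract B"
      "no_common_root N A" "no_common_root N B" by auto
    obtain A' B' where AB': "A' \<noteq> 0" "B' \<noteq> 0" "rf_iter i f powi k i = to_fract A' / to_fract B'"
      "no_common_root N A'" "no_common_root N B'"
      using pw[of i "k i"] cop[of i] insert by auto
    from AB AB' insert show ?case
      by (intro exI[of _ "A' * A"] exI[of _ "B' * B"]) (simp add: no_common_root_def ac.ev_mult)
  qed
  obtain A B where AB: "A \<noteq> 0" "B \<noteq> 0" "(\<Prod>i\<in>{1..<n}. rf_iter i f powi k i) = to_fract A / to_fract B"
      "no_common_root N A" "no_common_root N B" using rest[of "{1..<n}"] by auto
  obtain C D where CD: "C \<noteq> 0" "D \<noteq> 0" "rf_iter n f powi k n = to_fract C / to_fract D"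
      "N dvd C \<and> no_common_root N D \<or> N dvd D \<and> no_common_root N C"
    using pw[of n "k n"] k N by auto
  define F where "F = (\<Prod>i\<in>{1..n}. rf_iter i f powi k i)"
  have "{1..n} = insert n {1..<n}" using n by auto
  then have F: "F = to_fract (C * A) / to_fract (D * B)"
    by (simp add: F_def AB(3) CD(3) del: One_nat_def)
  have nd: "F = to_fract (rf_num F) / to_fract (rf_den F)" "rf_den F \<noteq> 0" using rf_num_den by blast+
  have "to_fract (rf_num F) / to_fract (rf_den F) = to_fract (C * A) / to_fract (D * B)"
    by (rule trans[OF nd(1)[symmetric] F])
  then have "to_fract (rf_num F * (D * B)) = to_fract (C * A * rf_den F)"
    using nd(2) AB CD by (simp add: frac_eq_eq)
  then have eq: "rf_num F * (D * B) = rf_den F * (C * A)" by (simp only: to_fract_eq_iff mult.commute)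
  have "rf_num F \<noteq> 0" using eq nd AB CD by auto
  have "N dvd rf_num F \<or> N dvd rf_den F"
    using CD(4)
  proof
    assume *: "N dvd C \<and> no_common_root N D"
    then have "no_common_root N (D * B)" using AB by (simp add: no_common_root_def ac.ev_mult)
    moreover have "N dvd rf_num F * (D * B)" unfolding eq using * by simp
    ultimately show ?thesis using N no_common_root_dvd_mult by blast
  next
    assume *: "N dvd D \<and> no_common_root N C"
    then have "no_common_root N (C * A)" using AB by (simp add: no_common_root_def ac.ev_mult)
    moreover have "N dvd rf_den F * (C * A)" unfolding eq[symmetric] using * by simp
    ultimately show ?thesis using N no_common_root_dvd_mult by blast
  qed
  then show ?thesis
    using \<open>rf_num F \<noteq> 0\<close> nd unfolding F_def[symmetric] rf_deg_def
    by (auto dest: dvd_imp_degree_le)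
qed

abbreviation (input) S :: "'a alg_closure option set" where "S \<equiv> {None, Some 0}"

definition orb :: "'a alg_closure option set" where
  "orb = {(act ^^ i) s | i s. s \<in> S}"

lemma orbI: "s \<in> S \<Longrightarrow> (act ^^ i) s \<in> orb"
  unfolding orb_def by blast

lemma no_common_root_orbit:
  assumes "\<And>x. ev to_ac N x = 0 \<Longrightarrow> (act ^^ m) (Some x) \<notin> S"
  shows "no_common_root N (num m) \<and> no_common_root N (den m)"
  using assms by (auto simp: no_common_root_def num_root_iff den_root_iff)

text \<open>\<open>Q\<close> is pulled back along the first \<open>n - s\<close> steps. Avoiding
  \<open>orb\<close> rules out visits to \<open>S\<close> in those steps, the second root hypothesis
  rules them out in the following ones, and \<open>M\<close> carries a multiplicity that comes from
  ramification.\<close>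

lemma degree_prod_ge_orbit:
  assumes Q: "degree Q > 0"
    and roots: "\<And>y. ev to_ac Q y = 0 \<Longrightarrow> Some y \<notin> orb"
      "\<And>y i. ev to_ac Q y = 0 \<Longrightarrow> 0 < i \<Longrightarrow> i < s \<Longrightarrow> (act ^^ i) (Some y) \<notin> S"
    and dvd: "Q ^ M dvd num s \<or> Q ^ M dvd den s"
    and n: "1 \<le> n" "s \<le> n" and k: "k n \<noteq> 0"
  shows "M * (degree Q * d ^ (n - s)) \<le> rf_deg (\<Prod>i\<in>{1..n}. rf_iter i f powi k i)"
proof -
  define j where "j = n - s"
  have nsj: "n = s + j" using n by (simp add: j_def)
  define N where "N = phomog (degree Q) Q (num j) (den j)"
  \<comment> \<open>Infinity is no zero of the form of \<open>Q\<close>, whose degree is exactly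
    that of \<open>Q\<close>.\<close>
  have hom0: "\<exists>y. pt u v = Some y \<and> ev to_ac Q y = 0"
    if "u \<noteq> 0 \<or> v \<noteq> 0" "homog to_ac (degree Q) Q u v = 0" for u v
  proof (cases "v = 0")
    case True
    with that Q show ?thesis by (auto simp: ac.homog_v0)
  next
    case False
    with that show ?thesis by (simp add: ac.homog_eq_ev pt_def)
  qed
  \<comment> \<open>If the degree dropped, infinity would reach a root of \<open>Q\<close> after
    \<open>j\<close> steps, putting that root in \<open>orb\<close>.\<close>
  have "to_ac (coeff N (degree Q * d ^ j)) \<noteq> 0"
  proof
    assume "to_ac (coeff N (degree Q * d ^ j)) = 0"
    then obtain y where "(act ^^ j) None = Some y" "ev to_ac Q y = 0"
      using hom0 top_num_den[of j] unfolding N_def coeff_phomog[OF degree_num_le degree_den_le]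
      by metis
    then show False using roots(1)[of y] orbI[of None j] by simp
  qed
  then have degN: "degree N = degree Q * d ^ j"
    using degree_phomog[OF degree_num_le[of j] degree_den_le[of j], of "degree Q" Q]
    by (intro antisym le_degree) (auto simp: N_def)
  have N0: "N \<noteq> 0" using degN Q deg_pos by auto
  have rootN: "\<exists>y. (act ^^ j) (Some x) = Some y \<and> ev to_ac Q y = 0" if "ev to_ac N x = 0" for x
    using that hom0 ev_num_den[of j x] unfolding N_def ev_phomog by metis
  have "degree (N ^ M) \<le> rf_deg (\<Prod>i\<in>{1..n}. rf_iter i f powi k i)"
  proof (rule degree_prod_ge)
    show "N ^ M \<noteq> 0" using N0 by simp
    show "N ^ M dvd num n \<or> N ^ M dvd den n"
      using dvd phomog_dvd[OF den_nz num_nz degree_num_le] phomog_dvd[OF den_nz den_nz degree_den_le]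
      unfolding nsj N_def by (auto simp: num_den_add)
    fix m assume m: "1 \<le> m" "m < n"
    show "no_common_root (N ^ M) (num m) \<and> no_common_root (N ^ M) (den m)"
    proof (rule no_common_root_orbit)
      fix x assume "ev to_ac (N ^ M) x = 0"
      then have "ev to_ac N x = 0" by (simp add: ac.ev_power)
      then obtain y where y: "(act ^^ j) (Some x) = Some y" "ev to_ac Q y = 0"
        using rootN by blast
      show "(act ^^ m) (Some x) \<notin> S"
      \<comment> \<open>Up to time \<open>j\<close> a visit to \<open>S\<close> would place
        \<open>y\<close> in \<open>orb\<close>; later, the path starts at \<open>y\<close> and has
        made fewer than \<open>s\<close> steps.\<close>
      proof (cases "m \<le> j")
        case True
        then have "(act ^^ (j - m)) ((act ^^ m) (Some x)) = Some y"
          using y by (metis add.commute funpow_add le_add_diff_inverse o_apply)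
        then have "Some y \<in> orb" if "(act ^^ m) (Some x) \<in> S"
          using orbI[OF that, of "j - m"] by simp
        then show ?thesis using roots(1)[OF y(2)] by blast
      next
        case False
        have "(act ^^ ((m - j) + j)) (Some x) = (act ^^ (m - j)) (Some y)"
          using y(1) unfolding funpow_add by simp
        then have "(act ^^ m) (Some x) = (act ^^ (m - j)) (Some y)"
          using False by simp
        moreover have "0 < m - j" "m - j < s" using False m nsj by auto
        ultimately show ?thesis using roots(2)[OF y(2), of "m - j"] by simp
      qed
    qed
  qed (use n k in auto)
  then show ?thesis
    using degN N0 by (simp add: degree_power_eq j_def)
qed

text \<open>The whole of \<open>num n\<close> or \<open>den n\<close> survives: a root that visits
  \<open>S\<close> at time \<open>m\<close> would give a return from \<open>S\<close> to
  \<open>S\<close> after \<open>n - m\<close> steps.\<close>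

lemma degree_prod_ge_no_return:
  assumes n: "n \<ge> 1" and k: "k n \<noteq> 0"
    and ret: "\<And>i s. 0 < i \<Longrightarrow> i < n \<Longrightarrow> s \<in> S \<Longrightarrow> (act ^^ i) s \<notin> S"
  shows "d ^ n \<le> rf_deg (\<Prod>i\<in>{1..n}. rf_iter i f powi k i)"
proof -
  obtain N where N: "degree N = d ^ n" "N = num n \<or> N = den n"
    using degree_num_or_den by blast
  have "degree N \<le> rf_deg (\<Prod>i\<in>{1..n}. rf_iter i f powi k i)"
  proof (rule degree_prod_ge)
    fix m assume m: "1 \<le> m" "m < n"
    show "no_common_root N (num m) \<and> no_common_root N (den m)"
    proof (rule no_common_root_orbit)
      fix x assume "ev to_ac N x = 0"
      then have "(act ^^ n) (Some x) \<in> S" using N num_root_iff den_root_iff by auto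
      moreover have "(act ^^ n) (Some x) = (act ^^ (n - m)) ((act ^^ m) (Some x))"
        using m by (metis funpow_add le_add_diff_inverse2 less_imp_le_nat o_apply)
      ultimately have "(act ^^ (n - m)) ((act ^^ m) (Some x)) \<in> S" by simp
      moreover have "0 < n - m" "n - m < n" using m by auto
      ultimately show "(act ^^ m) (Some x) \<notin> S"
        using ret by blast
    qed
  qed (use N num_nz den_nz n k in auto)
  then show ?thesis using N by simp
qed

section \<open>Surjectivity, and orbits that the map permutes\<close>

lemma surj_act: "surj act"
  unfolding surj_def
proof
  fix z show "\<exists>y. z = act y"
  proof (cases z)
    case None
    show ?thesis
    proof (cases "degree h > 0")
      case True
      then obtain x where "ev to_ac h x = 0" using ac_root_exists by blast
      then have "act (Some x) = None" by (simp add: act_Some pt_def)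
      with None show ?thesis by metis
    next
      case False
      then have "coeff h d = 0" using deg_pos by (intro coeff_eq_0) simp
      then have "act None = None" by (simp add: act_None pt_def)
      with None show ?thesis by metis
    qed
  next
    case (Some c)
    define q where "q = map_poly to_ac g - smult c (map_poly to_ac h)"
    show ?thesis
    proof (cases "degree q > 0")
      case True
      then obtain x where "poly q x = 0" using alg_closed_imp_poly_has_root by blast
      then have x: "ev to_ac g x = c * ev to_ac h x" by (simp add: q_def ev_def)
      then have "ev to_ac h x \<noteq> 0" using ev_gh[of x] by auto
      with x have "act (Some x) = Some c" by (simp add: act_Some pt_def)
      with Some show ?thesis by metis
    next
      \<comment> \<open>The equation \<open>g = c * h\<close> has lost its term of degree
        \<open>d\<close>, so infinity is the preimage.\<close>
      case False
      then have "coeff q d = 0" using deg_pos by (intro coeff_eq_0) simp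
      then have x: "to_ac (coeff g d) = c * to_ac (coeff h d)"
        by (simp add: q_def coeff_map_poly)
      then have "coeff h d \<noteq> 0" using coeff_d by auto
      with x have "act None = Some c" by (simp add: act_None pt_def)
      with Some show ?thesis by metis
    qed
  qed
qed

end

text \<open>Every point of \<open>{a, b}\<close> is reached again from \<open>{a, b}\<close>, which forces both points to be
  periodic; so \<open>Orb\<close> is a union of cycles.\<close>

lemma orbit_permuted:
  fixes \<phi> :: "'z \<Rightarrow> 'z" and a b :: 'z
  defines "Orb \<equiv> {(\<phi> ^^ i) s | i s. s \<in> {a, b}}"
  assumes surj: "surj \<phi>" and t: "t \<ge> 1"
    and closed: "\<And>y. (\<phi> ^^ t) y \<in> {a, b} \<Longrightarrow> y \<in> Orb"
  shows "\<And>u. \<phi> u \<in> {a, b} \<Longrightarrow> u \<in> Orb"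
    and "\<And>z. z \<in> Orb \<Longrightarrow> \<exists>z'\<in>Orb. \<phi> z' = z"
    and "inj_on \<phi> Orb"
proof -
  have add: "(\<phi> ^^ i) ((\<phi> ^^ j) z) = (\<phi> ^^ (i + j)) z" for i j z
    by (simp add: funpow_add)
  have surjn: "\<exists>y. (\<phi> ^^ n) y = z" for n z
    using surj_fn[OF surj, of n] by (metis surjD)
  have ret: "\<exists>i\<ge>1. \<exists>s\<in>{a, b}. (\<phi> ^^ i) s = v" if "v \<in> {a, b}" for v
  proof -
    obtain y where y: "(\<phi> ^^ t) y = v" using surjn by blast
    then have "y \<in> Orb" using closed that by metis
    then obtain i s where "y = (\<phi> ^^ i) s" "s \<in> {a, b}" by (auto simp: Orb_def)
    then show ?thesis using y t add by (intro exI[of _ "t + i"]) auto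
  qed
  \<comment> \<open>Among \<open>v\<close> and its successive origins \<open>s\<close>,
    \<open>s'\<close>, all in a set of two points, two coincide. If these are \<open>s\<close> and
    \<open>s'\<close>, then \<open>v\<close> lies on the cycle of \<open>s\<close>.\<close>
  have per: "\<exists>m\<ge>1. (\<phi> ^^ m) v = v" if v: "v \<in> {a, b}" for v
  proof -
    obtain i s where i: "i \<ge> 1" "s \<in> {a, b}" "(\<phi> ^^ i) s = v" using ret[OF v] by blast
    obtain j s' where j: "j \<ge> 1" "s' \<in> {a, b}" "(\<phi> ^^ j) s' = s" using ret[OF i(2)] by blast
    consider "s = v" | "s' = v" | "s' = s" using i j v by auto
    then show ?thesis
    proof cases
      case 1
      then show ?thesis using i(1,3) by (intro exI[of _ i]) simp
    next
      case 2
      have "(\<phi> ^^ (i + j)) v = (\<phi> ^^ i) ((\<phi> ^^ j) v)" by (simp only: add)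
      also have "\<dots> = v" using i(3) j(3) 2 by simp
      finally show ?thesis using i(1) by (intro exI[of _ "i + j"]) simp
    next
      case 3
      have "(\<phi> ^^ j) v = (\<phi> ^^ (j + i)) s" by (simp only: add flip: i(3))
      also have "\<dots> = (\<phi> ^^ i) ((\<phi> ^^ j) s)" by (simp only: add add.commute)
      also have "\<dots> = v" using i(3) j(3) 3 by simp
      finally show ?thesis using j(1) by (intro exI[of _ j]) simp
    qed
  qed
  obtain m where m: "m \<ge> 1" "(\<phi> ^^ m) a = a" using per[of a] by auto
  obtain n where n: "n \<ge> 1" "(\<phi> ^^ n) b = b" using per[of b] by auto
  have mult: "(\<phi> ^^ (p * q)) z = z" if "(\<phi> ^^ p) z = z" for p q z
    by (induction q) (use that in \<open>simp_all add: funpow_add\<close>)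
  \<comment> \<open>A common period of \<open>a\<close> and \<open>b\<close>, hence of all points of
    \<open>Orb\<close>; the iterate of order \<open>M - 1\<close> therefore inverts
    \<open>\<phi>\<close> on \<open>Orb\<close>.\<close>
  define M where "M = m * n"
  have M: "M \<ge> 1" using m n by (simp add: M_def)
  have "(\<phi> ^^ M) s = s" if "s \<in> {a, b}" for s
    using that mult[OF m(2), of n] mult[OF n(2), of m] by (auto simp: M_def mult.commute)
  then have perM: "(\<phi> ^^ M) z = z" if "z \<in> Orb" for z
  proof -
    obtain i s where z: "z = (\<phi> ^^ i) s" "s \<in> {a, b}" using \<open>z \<in> Orb\<close> by (auto simp: Orb_def)
    have "(\<phi> ^^ M) z = (\<phi> ^^ i) ((\<phi> ^^ M) s)" by (simp only: z(1) add add.commute)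
    then show ?thesis using \<open>\<And>s. s \<in> {a, b} \<Longrightarrow> (\<phi> ^^ M) s = s\<close>[OF z(2)] z(1) by simp
  qed
  have pred: "(\<phi> ^^ (M - 1)) (\<phi> z) = z" "\<phi> ((\<phi> ^^ (M - 1)) z) = z" if "z \<in> Orb" for z
    using perM[OF that] M by (cases M; simp add: funpow_swap1)+
  show "inj_on \<phi> Orb"
    by (rule inj_on_inverseI) (rule pred(1))
  have cl: "(\<phi> ^^ i) z \<in> Orb" if "z \<in> Orb" for i z
  proof -
    obtain j s where z: "z = (\<phi> ^^ j) s" "s \<in> {a, b}" using \<open>z \<in> Orb\<close> by (auto simp: Orb_def)
    show ?thesis unfolding Orb_def z(1) add using z(2) by blast
  qed
  show "\<exists>z'\<in>Orb. \<phi> z' = z" if "z \<in> Orb" for z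
    using pred(2)[OF that] cl[OF that] by blast
  show "u \<in> Orb" if u: "\<phi> u \<in> {a, b}" for u
  proof -
    \<comment> \<open>Stepping back \<open>t - 1\<close> times turns the image of \<open>u\<close>
      into a visit at time \<open>t\<close>, so that \<open>closed\<close> applies to
      \<open>y\<close>.\<close>
    obtain y where y: "(\<phi> ^^ (t - 1)) y = u" using surjn by blast
    have "(\<phi> ^^ t) y = \<phi> u"
      using y t by (cases t) auto
    then have "y \<in> Orb" using closed[of y] u by simp
    then show ?thesis using cl[of y "t - 1"] y by simp
  qed
qed

section \<open>New preimages of zero and infinity\<close>

lemma root_of_unity:
  assumes d: "d \<ge> 2" "\<And>l. d \<noteq> CHAR('k) ^ l"
  shows "\<exists>\<zeta>::'k::alg_closed_field. \<zeta> \<noteq> 1 \<and> \<zeta> ^ d = 1"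
proof -
  \<comment> \<open>In positive characteristic, \<open>m\<close> is what remains of \<open>d\<close>
    after removing all factors equal to the characteristic; it is not 1 because \<open>d\<close> is
    no power of the characteristic.\<close>
  obtain m where m: "m dvd d" "m \<ge> 2" "of_nat m \<noteq> (0::'k)"
  proof (cases "CHAR('k) = 0")
    case True
    with d show ?thesis using that[of d] by (auto simp: of_nat_eq_0_iff_char_dvd)
  next
    case False
    then have prime: "prime CHAR('k)" by (intro prime_CHAR_semidom) simp
    then have "\<not> is_unit CHAR('k)" using not_prime_unit by blast
    then obtain m where m: "d = CHAR('k) ^ multiplicity CHAR('k) d * m" "\<not> CHAR('k) dvd m"
      using d by (metis multiplicity_decompose' not_numeral_le_zero)
    moreover have "m \<noteq> 0" "m \<noteq> 1" using m d by (metis dvd_0_right, metis mult.right_neutral)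
    ultimately show ?thesis using that[of m] by (simp add: of_nat_eq_0_iff_char_dvd) (metis dvd_triv_right)
  qed
  have "m - 1 > 0" using m by simp
  \<comment> \<open>A root of \<open>1 + X + ... + X^(m-1)\<close> is an \<open>m\<close>-th root of
    unity, and it is not 1, where the sum takes the nonzero value \<open>m\<close>.\<close>
  from alg_closed[OF this, of "\<lambda>_. 1"] obtain \<zeta> :: 'k where z: "(\<Sum>k\<le>m - 1. \<zeta> ^ k) = 0"
    by auto
  have "{..m - 1} = {..<m}" using m by auto
  then have z': "(\<Sum>k<m. \<zeta> ^ k) = 0" using z by simp
  have "\<zeta> \<noteq> 1" using z' m by auto
  moreover have "1 - \<zeta> ^ m = 0" unfolding one_diff_power_eq z' by simp
  then have "\<zeta> ^ d = 1" using m(1) by (auto simp: power_mult)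
  ultimately show ?thesis by blast
qed

text \<open>Once all factors \<open>X - a\<close> are split off, a root of the cofactor would again
  be \<open>a\<close>, so the cofactor is constant.\<close>

lemma single_root_power:
  fixes R :: "'a::field poly"
  assumes "R \<noteq> 0" "\<And>x. ev to_ac R x = 0 \<Longrightarrow> x = to_ac a"
  obtains c where "c \<noteq> 0" "R = smult c ([:-a, 1:] ^ degree R)"
proof -
  obtain T where T: "R = [:-a, 1:] ^ Polynomial.order a R * T" "\<not> [:-a, 1:] dvd T"
    using order_decomp[OF assms(1)] by blast
  have "degree T = 0"
  proof (rule ccontr)
    assume "degree T \<noteq> 0"
    then obtain x where x: "ev to_ac T x = 0" using ac_root_exists by blast
    then have "ev to_ac R x = 0" using T(1) by (metis ac.ev_mult mult_zero_right)
    with assms x have "poly T a = 0" by (metis ev_to_ac to_ac_eq_0_iff)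
    with T show False by (simp add: poly_eq_0_iff_dvd)
  qed
  then obtain c where c: "T = [:c:]" by (metis degree_eq_zeroE)
  have R: "R = smult c ([:-a, 1:] ^ Polynomial.order a R)"
    using T(1) c by (metis mult.commute mult_pCons_left mult_zero_left pCons_0_0 add_0_right)
  moreover have "c \<noteq> 0" using R assms(1) by auto
  moreover have "degree R = Polynomial.order a R"
    by (subst R) (use \<open>c \<noteq> 0\<close> in \<open>simp add: degree_power_eq\<close>)
  ultimately show thesis using that by simp
qed

text \<open>The form of degree \<open>D\<close> attached to \<open>R\<close> can vanish only at
  \<open>z\<close>. A zero at infinity is covered by letting the linear form
  \<open>[:a0, a1:]\<close> degenerate to the constant 1.\<close>

lemma linear_power_form:
  fixes R :: "'a::field poly"
  assumes R: "R \<noteq> 0" "degree R \<le> D"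
    and z: "\<And>x. ev to_ac R x = 0 \<Longrightarrow> z = Some x" "coeff R D = 0 \<longleftrightarrow> z = None"
    and rat: "z = None \<or> (\<exists>s. z = Some (to_ac s))"
  obtains c a0 a1 where "c \<noteq> 0" "R = smult c ([:a0, a1:] ^ D)" "z = pt (to_ac (- a0)) (to_ac a1)"
    "a0 \<noteq> 0 \<or> a1 \<noteq> 0"
proof (cases "z = None")
  case True
  then have "degree R = 0" using z ac_root_exists[of R] by auto
  then obtain c where "R = [:c:]" by (metis degree_eq_zeroE)
  then show thesis using that[of c 1 0] R True by (auto simp: pt_def simp flip: one_pCons)
next
  case False
  then obtain s where s: "z = Some (to_ac s)" using rat by auto
  have "degree R = D" using z False R by (simp add: le_degree le_antisym)
  moreover obtain c where "c \<noteq> 0" "R = smult c ([:-s, 1:] ^ degree R)"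
    by (rule single_root_power[of R s]) (use R z s in auto)
  ultimately show thesis using that[of c "-s" 1] s by (simp add: pt_def)
qed

lemma (in coeff_hom_field) homog_linear_power:
  "homog c D (smult k ([:a0, a1:] ^ D)) u v = c k * (c a1 * u + c a0 * v) ^ D"
proof (cases "v = 0")
  case True
  have "coeff ([:a0, a1:] ^ D) (1 * D) = coeff [:a0, a1:] 1 ^ D"
    by (rule coeff_power_top) simp
  then show ?thesis using True by (simp add: homog_v0 c_mult c_power power_mult_distrib)
next
  case False
  have "degree (smult k ([:a0, a1:] ^ D)) \<le> degree [:a0, a1:] * D"
    by (rule order_trans[OF degree_smult_le degree_power_le])
  also have "\<dots> \<le> D" by simp
  finally have "homog c D (smult k ([:a0, a1:] ^ D)) u v = v ^ D * (c k * (c a0 + u / v * c a1) ^ D)"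
    using False by (simp add: homog_eq_ev ev_smult ev_power ev_pCons ev_0)
  also have "\<dots> = c k * (v * (c a0 + u / v * c a1)) ^ D"
    by (simp add: power_mult_distrib)
  also have "v * (c a0 + u / v * c a1) = c a1 * u + c a0 * v"
    using False by (simp add: field_simps)
  finally show ?thesis .
qed

lemma phomog_linear_power:
  "phomog D (smult k ([:- w, 1:] ^ D)) U V = smult k ((U - smult w V) ^ D)"
proof -
  have "rf_const (- w) = - rf_const w"
    by (simp add: rf_const_def flip: to_fract_uminus)
  then have "to_fract (phomog D (smult k ([:- w, 1:] ^ D)) U V)
      = rf_const k * (to_fract U - rf_const w * to_fract V) ^ D"
    by (simp add: to_fract_phomog rfc.homog_linear_power rfc.c_1)
  also have "\<dots> = to_fract ([:k:] * (U - [:w:] * V) ^ D)"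
    by (simp only: rf_const_def to_fract_mult to_fract_diff to_fract_power)
  finally show ?thesis by simp
qed

section \<open>Degree bounds from points outside the orbit\<close>

lemma (in ratmap) act_rational:
  assumes "z \<in> orb"
  shows "z = None \<or> (\<exists>s. z = Some (to_ac s))"
proof -
  have rat: "(act ^^ i) s = None \<or> (\<exists>x. (act ^^ i) s = Some (to_ac x))" if "s \<in> S" for i s
  proof (induction i)
    case 0
    then show ?case using that by (auto intro: exI[of _ 0])
  next
    case (Suc i)
    have pt: "pt (to_ac a) (to_ac b) = None \<or> (\<exists>x. pt (to_ac a) (to_ac b) = Some (to_ac x))" for a b :: 'a
      by (auto simp: pt_def simp flip: to_ac_divide)
    from Suc show ?case
    proof
      assume "(act ^^ i) s = None"
      then show ?thesis using pt[of "coeff g d" "coeff h d"] by (simp add: act_None)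
    next
      assume "\<exists>x. (act ^^ i) s = Some (to_ac x)"
      then obtain x where "(act ^^ i) s = Some (to_ac x)" ..
      then show ?thesis using pt[of "poly g x" "poly h x"] by (simp add: act_Some ev_to_ac)
    qed
  qed
  obtain i s where "z = (act ^^ i) s" "s \<in> S" using assms unfolding orb_def by blast
  then show ?thesis using rat[of s i] by simp
qed

lemma (in ratmap) act_funpow_add: "(act ^^ (i + j)) z = (act ^^ i) ((act ^^ j) z)"
  by (simp add: funpow_add)

text \<open>With \<open>Q\<close> the minimal polynomial of \<open>y\<close>, all conjugates of
  \<open>y\<close> avoid \<open>orb\<close>, whose points are rational, and reach the same point of
  \<open>S\<close> at time \<open>t\<close>. Hence \<open>H\<close> speaks of every
  \<open>y'\<close> with that image.\<close>

lemma (in ratmap) degree_prod_ge_new_point: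
  assumes y: "Some y \<notin> orb" "(act ^^ t) (Some y) \<in> S"
    and H: "\<And>y' i. (act ^^ t) (Some y') = (act ^^ t) (Some y) \<Longrightarrow> 0 < i \<Longrightarrow> i < t \<Longrightarrow>
              (act ^^ i) (Some y') \<notin> S"
    and n: "1 \<le> n" "t \<le> n" and k: "k n \<noteq> 0"
  shows "d ^ (n - t) \<le> rf_deg (\<Prod>i\<in>{1..n}. rf_iter i f powi k i)"
proof -
  obtain R where R: "R \<noteq> 0" "R = num t \<or> R = den t" "ev to_ac R y = 0"
    "\<And>x. ev to_ac R x = 0 \<Longrightarrow> (act ^^ t) (Some x) = (act ^^ t) (Some y)"
  proof (cases "(act ^^ t) (Some y) = None")
    case True
    then show thesis using that[of "den t"] den_nz by (simp add: den_root_iff)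
  next
    case False
    then have "(act ^^ t) (Some y) = Some 0" using y by auto
    then show thesis using that[of "num t"] num_nz by (simp add: num_root_iff)
  qed
  obtain Q where Q: "degree Q > 0" "\<And>P. ev to_ac P y = 0 \<Longrightarrow> Q dvd P"
    "\<And>s. ev to_ac Q (to_ac s) = 0 \<Longrightarrow> y = to_ac s"
    by (rule minimal_polynomial[OF R(1,3)]) blast
  have QR: "Q dvd R" using Q R by blast
  have "1 * (degree Q * d ^ (n - t)) \<le> rf_deg (\<Prod>i\<in>{1..n}. rf_iter i f powi k i)"
  proof (rule degree_prod_ge_orbit)
    show "Some y' \<notin> orb" if "ev to_ac Q y' = 0" for y'
    proof
      assume "Some y' \<in> orb"
      moreover from this obtain s where "y' = to_ac s" using act_rational by blast
      ultimately show False using Q(3)[of s] that y by simp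
    qed
    show "(act ^^ i) (Some y') \<notin> S" if "ev to_ac Q y' = 0" "0 < i" "i < t" for y' i
      using H R(4) ac.ev_dvd[OF QR that(1)] that by blast
    show "Q ^ 1 dvd num t \<or> Q ^ 1 dvd den t" using QR R(2) by auto
  qed (use Q n k in auto)
  moreover have "1 * d ^ (n - t) \<le> degree Q * d ^ (n - t)"
    using Q(1) by (intro mult_right_mono) auto
  ultimately show ?thesis by linarith
qed

text \<open>As \<open>w\<close> is the only point above \<open>v\<close>, the one of
  \<open>g\<close>, \<open>h\<close> that vanishes above \<open>v\<close> is a constant times
  \<open>(X - w)^d\<close>. The minimal polynomial of \<open>r\<close> thus enters
  \<open>num 2\<close> or \<open>den 2\<close> to the power \<open>d\<close>, and
  \<open>d * d ^ (n - 2) = d ^ (n - 1)\<close>.\<close>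

lemma (in ratmap) degree_prod_ge_ramified:
  assumes v: "v \<in> S" "\<And>u. act u = v \<Longrightarrow> u = Some (to_ac w)" and w: "w \<noteq> 0"
    and r: "act (Some r) = Some (to_ac w)" "Some r \<notin> orb"
    and n: "2 \<le> n" and k: "k n \<noteq> 0"
  shows "d ^ (n - 1) \<le> rf_deg (\<Prod>i\<in>{1..n}. rf_iter i f powi k i)"
proof -
  define R where "R = num 1 - smult w (den 1)"
  have act1: "act (Some x) = pt (ev to_ac (num 1) x) (ev to_ac (den 1) x)" for x
    using ev_num_den[of 1 x] by simp
  have R: "ev to_ac R x = 0 \<longleftrightarrow> act (Some x) = Some (to_ac w)" for x
    using ev_num_den[of 1 x] by (auto simp: R_def ac.ev_diff ac.ev_smult act1 pt_def field_simps)
  have "R \<noteq> 0"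
  proof
    assume "R = 0"
    then have num: "num 1 = smult w (den 1)" by (simp add: R_def)
    have "degree (den 1) = 0"
    proof (rule ccontr)
      assume "degree (den 1) \<noteq> 0"
      then obtain x where "ev to_ac (den 1) x = 0" using ac_root_exists by blast
      then show False using ev_num_den[of 1 x] unfolding num ac.ev_smult by simp
    qed
    then show False using degree_num_or_den[of 1] num w deg_pos by auto
  qed
  obtain Q where Q: "degree Q > 0" "\<And>P. ev to_ac P r = 0 \<Longrightarrow> Q dvd P"
    "\<And>s. ev to_ac Q (to_ac s) = 0 \<Longrightarrow> r = to_ac s"
    by (rule minimal_polynomial[OF \<open>R \<noteq> 0\<close>]) (use R r in auto)
  have QR: "Q dvd R" using Q R r by blast
  have pow: "\<exists>c. P = smult c ([:- w, 1:] ^ d)"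
    if P: "P \<noteq> 0" "degree P \<le> d" "coeff P d \<noteq> 0" "\<And>x. ev to_ac P x = 0 \<Longrightarrow> act (Some x) = v" for P
  proof -
    have "degree P = d" using P by (simp add: le_degree le_antisym)
    moreover obtain c where "c \<noteq> 0" "P = smult c ([:-w, 1:] ^ degree P)"
      by (rule single_root_power[of P w]) (use P v in auto)
    ultimately show ?thesis by auto
  qed
  have dvdR: "Q ^ d dvd phomog d P (num 1) (den 1)" if "P = smult c ([:- w, 1:] ^ d)" for P c
    unfolding that phomog_linear_power using QR by (auto simp: R_def intro!: dvd_smult dvd_power_same)
  \<comment> \<open>Infinity does not lie above \<open>v\<close>, so the polynomial in question has
    full degree \<open>d\<close>.\<close>
  have None: "act None \<noteq> v" using v(2) by blast
  have 2: "num 2 = phomog d g (num 1) (den 1)" "den 2 = phomog d h (num 1) (den 1)"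
    using num_den_Suc[of 1] by (simp_all add: numeral_2_eq_2)
  have Qdvd: "Q ^ d dvd num 2 \<or> Q ^ d dvd den 2"
  proof (cases "v = None")
    case True
    then have "coeff h d \<noteq> 0" using None by (auto simp: act_None pt_def)
    moreover have "act (Some x) = v" if "ev to_ac h x = 0" for x
      using that True by (simp add: act_Some pt_def)
    ultimately obtain c where "h = smult c ([:- w, 1:] ^ d)"
      using pow[of h] rf_num_den(4)[of f] degree_h_le by blast
    then show ?thesis unfolding 2 using dvdR by blast
  next
    case False
    then have v0: "v = Some 0" using v by auto
    then have gd: "coeff g d \<noteq> 0" using None coeff_d by (auto simp: act_None pt_def)
    moreover have "act (Some x) = v" if "ev to_ac g x = 0" for x
      using that v0 ev_gh[of x] by (simp add: act_Some pt_def)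
    moreover have "g \<noteq> 0" using gd by auto
    ultimately obtain c where "g = smult c ([:- w, 1:] ^ d)"
      using pow[of g] degree_g_le by blast
    then show ?thesis unfolding 2 using dvdR by blast
  qed
  have "d * (degree Q * d ^ (n - 2)) \<le> rf_deg (\<Prod>i\<in>{1..n}. rf_iter i f powi k i)"
  proof (rule degree_prod_ge_orbit)
    show "Some y \<notin> orb" if "ev to_ac Q y = 0" for y
    proof
      assume "Some y \<in> orb"
      moreover from this obtain s where "y = to_ac s" using act_rational by blast
      ultimately show False using Q(3)[of s] that r(2) by simp
    qed
    show "(act ^^ i) (Some y) \<notin> S" if "ev to_ac Q y = 0" "0 < i" "i < 2" for y i
    proof -
      have "i = 1" using that by auto
      then show ?thesis using R[of y] ac.ev_dvd[OF QR that(1)] w by simp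
    qed
  qed (use Q n k Qdvd in auto)
  moreover have "d ^ (n - 1) = d * d ^ (n - 2)"
    using n by (metis Suc_1 Suc_diff_Suc Suc_le_lessD power_Suc)
  moreover have "d * (1 * d ^ (n - 2)) \<le> d * (degree Q * d ^ (n - 2))"
    using Q(1) by (intro mult_left_mono mult_right_mono) auto
  ultimately show ?thesis by linarith
qed

text \<open>Infinity belongs to \<open>orb\<close>, so a hypothesis on finite points suffices for
  \<open>orbit_permuted\<close>.\<close>

lemma (in ratmap) preimages_in_orbit:
  assumes t: "t \<ge> 1" and no: "\<And>y. Some y \<notin> orb \<Longrightarrow> (act ^^ t) (Some y) \<notin> S"
  shows "\<And>u. act u \<in> S \<Longrightarrow> u \<in> orb"
    and "\<And>z. z \<in> orb \<Longrightarrow> \<exists>z'\<in>orb. act z' = z"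
    and "inj_on act orb"
proof -
  have cl: "z \<in> orb" if "(act ^^ t) z \<in> S" for z
    using that no[of "the z"] orbI[of None 0] by (cases z) auto
  note * = orbit_permuted[OF surj_act t, of None "Some 0", folded orb_def, OF cl]
  show "\<And>u. act u \<in> S \<Longrightarrow> u \<in> orb" "\<And>z. z \<in> orb \<Longrightarrow> \<exists>z'\<in>orb. act z' = z" "inj_on act orb"
    using * by blast+
qed

section \<open>Numerator and denominator of unequal positive degrees\<close>

lemma Psi_geI:
  assumes "\<And>k. k n \<noteq> 0 \<Longrightarrow> B \<le> rf_deg (\<Prod>i\<in>{1..n}. rf_iter i f powi k i)"
  shows "B \<le> Psi f n"
  unfolding Psi_def
proof (rule cInf_greatest)
  show "{rf_deg (\<Prod>i\<in>{1..n}. rf_iter i f powi k i) |k :: nat \<Rightarrow> int. k n \<noteq> 0} \<noteq> {}"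
    by (auto intro!: exI[of _ "\<lambda>_. 1"])
qed (use assms in auto)

text \<open>Unequal degrees send infinity into \<open>S\<close>, and a root of the polynomial of
  smaller degree is a finite point with the same image. So \<open>act\<close> is not injective on
  the preimages of \<open>S\<close>, and a new point exists already for
  \<open>t = 1\<close>.\<close>

lemma (in ratmap) Psi_ge_mixed:
  assumes deg: "degree g > degree h \<and> degree h \<ge> 1 \<or> 1 \<le> degree g \<and> degree g < degree h"
    and n: "n \<ge> 1"
  shows "d ^ (n - 1) \<le> Psi f n"
proof -
  have "\<exists>y. Some y \<notin> orb \<and> (act ^^ 1) (Some y) \<in> S"
  proof (rule ccontr)
    assume "\<not> ?thesis"
    then have no: "(act ^^ 1) (Some y) \<notin> S" if "Some y \<notin> orb" for y using that by blast
    note * = preimages_in_orbit[OF order_refl no]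
    obtain x where x: "act (Some x) = act None" "act None \<in> S"
      using deg
    proof
      assume deg: "degree g > degree h \<and> degree h \<ge> 1"
      then obtain x where "ev to_ac h x = 0" using ac_root_exists[of h] by auto
      moreover have "coeff h d = 0" using deg by (intro coeff_eq_0) (simp add: rf_deg_def)
      ultimately show thesis using that[of x] by (simp add: act_Some act_None pt_def)
    next
      assume deg: "1 \<le> degree g \<and> degree g < degree h"
      then obtain x where "ev to_ac g x = 0" using ac_root_exists[of g] by auto
      moreover have "coeff g d = 0" using deg by (intro coeff_eq_0) (simp add: rf_deg_def)
      ultimately show thesis
        using that[of x] coeff_d ev_gh[of x] by (simp add: act_Some act_None pt_def)
    qed
    have "Some x \<in> orb" "None \<in> orb" using *(1)[of "Some x"] *(1)[of None] x by auto
    then show False using *(3) x(1) by (auto dest: inj_onD)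
  qed
  then obtain y where y: "Some y \<notin> orb" "(act ^^ 1) (Some y) \<in> S" by blast
  show ?thesis
    by (rule Psi_geI, rule degree_prod_ge_new_point[OF y]) (use n in auto)
qed

section \<open>Degrees that are powers of the characteristic\<close>

lemma prime_power_char:
  assumes "d = CHAR('a::field) ^ l" "d \<ge> 2"
  shows "prime CHAR('a)" "l \<ge> 1" "of_nat d = (0::'a)"
proof -
  show l: "l \<ge> 1" using assms by (cases l) auto
  have "CHAR('a) \<noteq> 0" using assms l by (intro notI) (simp add: power_0_left)
  then show "prime CHAR('a)" by (intro prime_CHAR_semidom) simp
  show "of_nat d = (0::'a)"
    unfolding of_nat_eq_0_iff_char_dvd assms(1) using l by (simp add: dvd_power)
qed

lemma linear_power_prime_power:
  fixes a0 a1 :: "'a::field"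
  assumes "d = CHAR('a) ^ l" "d \<ge> 2"
  shows "to_fract ([:a0, a1:] ^ d) = rf_const (a0 ^ d) + rf_const (a1 ^ d) * rf_X ^ d"
proof -
  have cp: "[:x:] ^ n = [:x ^ n:]" for x :: 'a and n
    by (induction n) (simp_all add: one_pCons)
  have "[:a0, a1:] = [:a0:] + [:a1:] * [:0, 1:]" by simp
  also have "\<dots> ^ d = [:a0:] ^ d + ([:a1:] * [:0, 1:]) ^ d"
    by (rule freshmans_dream'[where n = l]) (use assms prime_power_char[OF assms] in simp_all)
  finally have "[:a0, a1:] ^ d = [:a0 ^ d:] + [:a1 ^ d:] * [:0, 1:] ^ d"
    by (simp only: power_mult_distrib cp)
  then show ?thesis
    by (simp only: rf_const_def rf_X_def to_fract_add to_fract_mult to_fract_power)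
qed

text \<open>The reduced numerator is a constant multiple of \<open>num k\<close>. This makes
  \<open>zero_index\<close> the first return time of 0 to itself.\<close>

lemma (in ratmap) zero_at_0_iter: "zero_at_0 (rf_iter k f) \<longleftrightarrow> (act ^^ k) (Some 0) = Some 0"
proof -
  obtain a where "a \<noteq> 0" "rf_num (rf_iter k f) = smult a (num k)"
    by (rule rf_num_den_unique[OF rf_iter_eq den_nz no_common_root_num_den]) blast
  then have "zero_at_0 (rf_iter k f) \<longleftrightarrow> ev to_ac (num k) (to_ac 0) = 0"
    by (simp add: zero_at_0_def ev_to_ac del: to_ac_0)
  then show ?thesis by (simp add: num_root_iff)
qed

lemma rf_num_den_to_fract:
  assumes "f = to_fract q"
  shows "rf_num f = q" "rf_den f = 1"
proof -
  have "no_common_root q 1" by (simp add: no_common_root_def ac.ev_1)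
  then obtain a where "rf_num f = smult a q" "rf_den f = smult a 1"
    using rf_num_den_unique[of f q 1] assms by (metis div_by_1 one_neq_zero to_fract_1)
  then show "rf_num f = q" "rf_den f = 1" using rf_num_den(3)[of f] by simp_all
qed

section \<open>Polynomial maps\<close>

locale polymap = ratmap +
  assumes den_1: "rf_den f = 1" and deg2: "rf_deg f \<ge> 2"
begin

lemma f_eq: "f = to_fract g"
  using rf_num_den(1)[of f] den_1 by simp

lemma degree_g: "degree g = d"
  by (simp add: rf_deg_def den_1)

lemma act_poly: "act (Some x) = Some (ev to_ac g x)" "act None = None"
  using deg2 by (simp_all add: act_Some act_None den_1 pt_def ac.ev_1 coeff_1)

lemma act_poly_iter: "\<exists>y. (act ^^ i) (Some x) = Some y" "(act ^^ i) None = None"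
  by (induction i) (auto simp: act_poly)

lemma surj_iter: "\<exists>y. (act ^^ i) (Some y) = Some z"
proof -
  obtain u where "(act ^^ i) u = Some z" using surj_fn[OF surj_act, of i] by (metis surjD)
  then show ?thesis using act_poly_iter(2)[of i] by (cases u) auto
qed

text \<open>No finite point reaches infinity, so \<open>den n\<close> is constant and
  \<open>num n\<close> has degree \<open>d ^ n\<close>. Only an early return of 0 to itself could
  let its roots visit \<open>S\<close> too soon.\<close>

lemma Psi_ge_before_return:
  assumes n: "n \<ge> 1" and ret: "\<And>i. 0 < i \<Longrightarrow> i < n \<Longrightarrow> (act ^^ i) (Some 0) \<noteq> Some 0"
  shows "d ^ n \<le> Psi f n"
proof (rule Psi_geI)
  fix k :: "nat \<Rightarrow> int" assume k: "k n \<noteq> 0"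
  have "degree (den n) = 0"
  proof (rule ccontr)
    assume "degree (den n) \<noteq> 0"
    then obtain x where "ev to_ac (den n) x = 0" using ac_root_exists by blast
    then show False using act_poly_iter(1)[of n x] by (simp add: den_root_iff)
  qed
  then have deg: "degree (num n) = d ^ n" using degree_num_or_den[of n] deg2 by auto
  have "degree (num n) \<le> rf_deg (\<Prod>i\<in>{1..n}. rf_iter i f powi k i)"
  proof (rule degree_prod_ge)
    fix m assume m: "1 \<le> m" "m < n"
    show "no_common_root (num n) (num m) \<and> no_common_root (num n) (den m)"
    proof (rule no_common_root_orbit)
      fix x assume "ev to_ac (num n) x = 0"
      then have "(act ^^ (n - m + m)) (Some x) = Some 0" using m by (simp add: num_root_iff)
      then have "(act ^^ m) (Some x) = Some 0 \<Longrightarrow> (act ^^ (n - m)) (Some 0) = Some 0"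
        unfolding act_funpow_add by simp
      moreover have "0 < n - m" "n - m < n" using m by auto
      ultimately show "(act ^^ m) (Some x) \<notin> S"
        using ret[of "n - m"] act_poly_iter(1)[of m x] by auto
    qed
  qed (use num_nz n k in auto)
  then show "d ^ n \<le> rf_deg (\<Prod>i\<in>{1..n}. rf_iter i f powi k i)" using deg by simp
qed

text \<open>Otherwise the points on the cycle of 0 involved in its last steps have a single preimage
  each. The last step gives \<open>g = c (X - a)^d\<close>, a monomial if \<open>e = 1\<close>; if
  not, the step into \<open>a\<close> forces \<open>d\<close> to be a power of the characteristic
  and \<open>f\<close> to be a binomial.\<close>

lemma other_preimage_of_0:
  assumes not_mono: "\<not> rf_monomial f"
    and not_binom: "\<not> (\<exists>a b (l::nat). a \<noteq> 0 \<and> f = rf_const a * rf_X ^ (CHAR('a) ^ l) + rf_const b)"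
    and e: "e \<ge> 1" "(act ^^ e) (Some 0) = Some 0" "\<And>i. 0 < i \<Longrightarrow> i < e \<Longrightarrow> (act ^^ i) (Some 0) \<noteq> Some 0"
  shows "\<exists>y. y \<noteq> 0 \<and> (act ^^ e) (Some y) = Some 0"
proof (rule ccontr)
  assume "\<not> ?thesis"
  then have no: "y = 0" if "(act ^^ e) (Some y) = Some 0" for y using that by blast
  have e': "Suc (e - 1) = e" using e by simp
  obtain x where x: "(act ^^ (e - 1)) (Some 0) = Some x" using act_poly_iter by blast
  have "Some x \<in> orb" unfolding x[symmetric] by (rule orbI) simp
  then obtain a where a: "x = to_ac a" using act_rational by blast
  have act_a: "act (Some (to_ac a)) = Some 0"
  proof -
    have "(act ^^ Suc (e - 1)) (Some 0) = Some 0" using e e' by simp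
    then show ?thesis using x a by simp
  qed
  \<comment> \<open>Any such \<open>u\<close> is reached from somewhere in \<open>e - 1\<close>
    steps, and only 0 can be the starting point.\<close>
  have uniq_a: "u = to_ac a" if "act (Some u) = Some 0" for u
  proof -
    obtain y where y: "(act ^^ (e - 1)) (Some y) = Some u" using surj_iter by blast
    then have "(act ^^ Suc (e - 1)) (Some y) = Some 0" using that by simp
    then have "y = 0" using no e' by simp
    then show ?thesis using x y a by simp
  qed
  have g0: "g \<noteq> 0" using degree_g deg2 by auto
  obtain c where c: "c \<noteq> 0" "g = smult c ([:-a, 1:] ^ d)"
    by (rule single_root_power[of g a]) (use g0 uniq_a act_poly degree_g in auto)
  show False
  proof (cases "e = 1")
    case True
    then have "a = 0" using x a by simp
    have "g = [:c:] * [:0, 1:] ^ d" using c \<open>a = 0\<close> by simp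
    then have "f = rf_const c * rf_X ^ d"
      using f_eq by (simp only: rf_const_def rf_X_def to_fract_mult to_fract_power)
    then have "f = rf_const c * rf_X powi (int d)" by simp
    then show False using not_mono c(1) unfolding rf_monomial_def by blast
  next
    case False
    then have e2: "e \<ge> 2" using e by simp
    then have e'': "Suc (Suc (e - 2)) = e" "Suc (e - 2) = e - 1" by auto
    have "a \<noteq> 0" using e(3)[of "e - 1"] x a e2 by auto
    obtain b where b: "(act ^^ (e - 2)) (Some 0) = Some b" using act_poly_iter by blast
    have "(act ^^ Suc (e - 2)) (Some 0) = Some (to_ac a)" using x a e'' by simp
    then have act_b: "act (Some b) = Some (to_ac a)" using b by simp
    have uniq_b: "u = b" if u: "act (Some u) = Some (to_ac a)" for u
    proof -
      obtain y where y: "(act ^^ (e - 2)) (Some y) = Some u" using surj_iter by blast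
      then have "(act ^^ Suc (Suc (e - 2))) (Some y) = Some 0" using u act_a by simp
      then have "y = 0" using no e'' by simp
      then show ?thesis using y b by simp
    qed
    have evg: "ev to_ac g u = to_ac c * (u - to_ac a) ^ d" for u
      by (subst c(2)) (simp add: ac.ev_smult ac.ev_power ac.ev_pCons ac.ev_0)
    have "\<exists>l. d = CHAR('a) ^ l"
    proof (rule ccontr)
      assume "\<not> ?thesis"
      then obtain z :: "'a alg_closure" where z: "z \<noteq> 1" "z ^ d = 1"
        using root_of_unity[where 'k = "'a alg_closure", of d] deg2 by auto
      \<comment> \<open>Rotating \<open>b\<close> about \<open>a\<close> by a root of unity keeps
        \<open>(b - a)^d\<close>, so uniqueness gives \<open>b = a\<close>; yet \<open>a\<close>
        maps to 0 and \<open>b\<close> maps to \<open>a \<noteq> 0\<close>.\<close>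
      have "ev to_ac g (to_ac a + z * (b - to_ac a)) = ev to_ac g b"
        by (simp add: evg power_mult_distrib z)
      then have "act (Some (to_ac a + z * (b - to_ac a))) = Some (to_ac a)"
        using act_b by (simp only: act_poly(1))
      then have "to_ac a + z * (b - to_ac a) = b" by (rule uniq_b)
      then have "(z - 1) * (b - to_ac a) = 0" by (simp add: algebra_simps)
      then have "b = to_ac a" using z by simp
      then show False using act_a act_b \<open>a \<noteq> 0\<close> by simp
    qed
    then obtain l where l: "d = CHAR('a) ^ l" ..
    have "f = rf_const c * to_fract ([:-a, 1:] ^ d)"
    proof -
      have "g = [:c:] * [:-a, 1:] ^ d" using c(2) by simp
      then show ?thesis using f_eq by (simp only: rf_const_def to_fract_mult)
    qed
    also have "\<dots> = rf_const c * rf_X ^ d + rf_const (c * (- a) ^ d)"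
      by (simp add: linear_power_prime_power[OF l deg2] rfc.c_1 rfc.c_mult algebra_simps)
    finally show False using not_binom c(1) l by metis
  qed
qed

text \<open>Apart from infinity, \<open>orb\<close> is the cycle of 0, which the iterate of order
  \<open>e\<close> fixes pointwise; it sends \<open>y\<close> to 0, so \<open>y\<close> is outside.
  A visit to 0 before time \<open>e\<close> would make 0 return too early.\<close>

lemma Psi_ge_after_return:
  assumes y: "y \<noteq> 0" "(act ^^ e) (Some y) = Some 0"
    and e: "(act ^^ e) (Some 0) = Some 0" "\<And>i. 0 < i \<Longrightarrow> i < e \<Longrightarrow> (act ^^ i) (Some 0) \<noteq> Some 0"
    and n: "n \<ge> 1" "n \<ge> e"
  shows "d ^ (n - e) \<le> Psi f n"
proof (rule Psi_geI, rule degree_prod_ge_new_point)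
  show "(act ^^ e) (Some y) \<in> S" using y by simp
  show "Some y \<notin> orb"
  proof
    assume "Some y \<in> orb"
    then obtain i s where i: "Some y = (act ^^ i) s" "s \<in> S" unfolding orb_def by blast
    then have "Some y = (act ^^ i) (Some 0)" using act_poly_iter(2)[of i] by auto
    then have "(act ^^ e) (Some y) = (act ^^ i) ((act ^^ e) (Some 0))"
      by (simp only: act_funpow_add[symmetric] add.commute)
    then show False using y e \<open>Some y = (act ^^ i) (Some 0)\<close> by simp
  qed
  fix y' i assume a: "(act ^^ e) (Some y') = (act ^^ e) (Some y)" "0 < i" "i < e"
  then have "(act ^^ ((e - i) + i)) (Some y') = Some 0" using y by simp
  then have "(act ^^ i) (Some y') = Some 0 \<Longrightarrow> (act ^^ (e - i)) (Some 0) = Some 0"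
    unfolding act_funpow_add by simp
  moreover have "0 < e - i" "e - i < e" using a by auto
  ultimately show "(act ^^ i) (Some y') \<notin> S"
    using e(2)[of "e - i"] act_poly_iter(1)[of i y'] by auto
qed (use n in auto)

end

section \<open>Maps totally ramified over 0 and infinity\<close>

context ratmap
begin

lemma act_linear_power:
  assumes "g = smult \<alpha> ([:a0, a1:] ^ d)" "h = smult \<beta> ([:b0, b1:] ^ d)" "u \<noteq> 0 \<or> v \<noteq> 0"
  shows "act (pt u v) = pt (to_ac \<alpha> * (to_ac a1 * u + to_ac a0 * v) ^ d) (to_ac \<beta> * (to_ac b1 * u + to_ac b0 * v) ^ d)"
  unfolding act_pt[OF assms(3)] by (simp only: assms(1,2) ac.homog_linear_power)

end

lemma to_fract_linear_power:
  "to_fract (smult \<alpha> ([:a0, a1:] ^ n)) = rf_const \<alpha> * (rf_const a0 + rf_const a1 * rf_X) ^ n"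
proof -
  have "smult \<alpha> ([:a0, a1:] ^ n) = [:\<alpha>:] * ([:a0:] + [:a1:] * [:0, 1:]) ^ n" by simp
  then show ?thesis by (simp only: rf_const_def rf_X_def to_fract_add to_fract_mult to_fract_power)
qed

lemma pt_eqI:
  "u \<noteq> 0 \<or> v \<noteq> 0 \<Longrightarrow> u' \<noteq> 0 \<or> v' \<noteq> 0 \<Longrightarrow> u * v' = u' * v \<Longrightarrow> pt u v = pt u' v'"
  by (auto simp: pt_def field_simps)

lemma pt_eqD:
  "u \<noteq> 0 \<or> v \<noteq> 0 \<Longrightarrow> u' \<noteq> 0 \<or> v' \<noteq> 0 \<Longrightarrow> pt u v = pt u' v' \<Longrightarrow> u * v' = u' * v"
  by (auto simp: pt_def field_simps split: if_splits)

lemma pt_cases: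
  obtains u v where "(u :: 'k::field) \<noteq> 0 \<or> v \<noteq> 0" "z = pt u v"
proof (cases z)
  case None
  then show thesis using that[of 1 0] by (simp add: pt_def)
next
  case (Some x)
  then show thesis using that[of x 1] by (simp add: pt_def)
qed

context ratmap
begin

lemma totally_ramified_num:
  assumes "\<And>u. act u = Some 0 \<longleftrightarrow> u = z" "z \<in> orb"
  obtains c a0 a1 where "c \<noteq> 0" "g = smult c ([:a0, a1:] ^ d)" "z = pt (to_ac (- a0)) (to_ac a1)"
    "a0 \<noteq> 0 \<or> a1 \<noteq> 0"
proof (rule linear_power_form[of g d z])
  show "g \<noteq> 0"
  proof
    assume g: "g = 0"
    then have "degree h > 0" using deg_pos by (simp add: rf_deg_def)
    then obtain x where "ev to_ac h x = 0" using ac_root_exists by blast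
    then show False using ev_gh[of x] g by (simp add: ac.ev_0)
  qed
  show "z = Some x" if "ev to_ac g x = 0" for x
  proof -
    have "act (Some x) = Some 0" using that ev_gh[of x] by (simp add: act_Some pt_def)
    then show ?thesis using assms(1) by metis
  qed
  have "coeff g d = 0 \<longleftrightarrow> act None = Some 0" using coeff_d by (auto simp: act_None pt_def)
  then show "coeff g d = 0 \<longleftrightarrow> z = None" using assms(1) by metis
  show "z = None \<or> (\<exists>s. z = Some (to_ac s))" by (rule act_rational) fact
qed (use degree_g_le in auto)

lemma totally_ramified_den:
  assumes "\<And>u. act u = None \<longleftrightarrow> u = z" "z \<in> orb"
  obtains c a0 a1 where "c \<noteq> 0" "h = smult c ([:a0, a1:] ^ d)" "z = pt (to_ac (- a0)) (to_ac a1)"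
    "a0 \<noteq> 0 \<or> a1 \<noteq> 0"
proof (rule linear_power_form[of h d z])
  show "h \<noteq> 0" by (rule rf_num_den)
  show "z = Some x" if "ev to_ac h x = 0" for x
  proof -
    have "act (Some x) = None" using that by (simp add: act_Some pt_def)
    then show ?thesis using assms(1) by metis
  qed
  have "coeff h d = 0 \<longleftrightarrow> act None = None" by (auto simp: act_None pt_def)
  then show "coeff h d = 0 \<longleftrightarrow> z = None" using assms(1) by metis
  show "z = None \<or> (\<exists>s. z = Some (to_ac s))" by (rule act_rational) fact
qed (use degree_h_le in auto)

text \<open>Raising to the power \<open>d\<close> is additive, which turns \<open>f\<close> into a
  fraction of degree one in \<open>X ^ d\<close>; derivatives vanish because \<open>d\<close> is
  zero in the field.\<close>

lemma linear_power_quotient_frobenius: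
  assumes gh: "g = smult \<alpha> ([:a0, a1:] ^ d)" "h = smult \<beta> ([:b0, b1:] ^ d)"
    and nz: "\<alpha> \<noteq> 0" "\<beta> \<noteq> 0" and det: "a1 * b0 - a0 * b1 \<noteq> 0"
    and l: "d = CHAR('a) ^ l" and d2: "d \<ge> 2"
  shows "\<not> rf_separable f" "\<exists>L. rf_deg L = 1 \<and> f = rf_comp L (rf_X ^ d)"
proof -
  note pp = prime_power_char[OF l d2]
  have "pderiv g = 0" "pderiv h = 0"
    by (subst gh; simp only: pderiv_smult pderiv_power pp(3) smult_0_left smult_0_right)+
  then show "\<not> rf_separable f" by (simp add: rf_separable_def rf_deriv_def)
  define N where "N = [:\<alpha> * a0 ^ d, \<alpha> * a1 ^ d:]"
  define D where "D = [:\<beta> * b0 ^ d, \<beta> * b1 ^ d:]"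
  \<comment> \<open>The determinant of \<open>L\<close> is \<open>\<alpha> * \<beta>\<close> times
    the difference of these two powers, which equals the \<open>d\<close>-th power of the given
    determinant.\<close>
  have det_pow: "(a1 * b0) ^ d \<noteq> (a0 * b1) ^ d"
  proof
    assume eq: "(a1 * b0) ^ d = (a0 * b1) ^ d"
    have "(a1 * b0 - a0 * b1 + a0 * b1) ^ d = (a1 * b0 - a0 * b1) ^ d + (a0 * b1) ^ d"
      by (rule freshmans_dream'[OF pp(1) l])
    then show False using eq det d2 by simp
  qed
  have "no_common_root N D"
    unfolding no_common_root_def
  proof (intro allI impI notI)
    fix x assume "ev to_ac N x = 0" "ev to_ac D x = 0"
    then have A: "to_ac (\<alpha> * a0 ^ d) = - x * to_ac (\<alpha> * a1 ^ d)"
      and B: "to_ac (\<beta> * b0 ^ d) = - x * to_ac (\<beta> * b1 ^ d)"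
      by (simp_all add: N_def D_def ac.ev_pCons ac.ev_0 add_eq_0_iff2 del: to_ac_mult to_ac_power)
    have "to_ac (\<alpha> * a1 ^ d) * to_ac (\<beta> * b0 ^ d) = to_ac (\<alpha> * a0 ^ d) * to_ac (\<beta> * b1 ^ d)"
      unfolding A B by simp
    then have "to_ac ((\<alpha> * \<beta>) * (a1 * b0) ^ d) = to_ac ((\<alpha> * \<beta>) * (a0 * b1) ^ d)"
      by (simp add: power_mult_distrib ac_simps)
    then have "(\<alpha> * \<beta>) * (a1 * b0) ^ d = (\<alpha> * \<beta>) * (a0 * b1) ^ d"
      by (simp only: to_ac_eq_iff)
    then show False using nz det_pow by simp
  qed
  moreover have "D \<noteq> 0" using det nz by (auto simp: D_def)
  moreover define L where "L = to_fract N / to_fract D"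
  ultimately have L: "rf_deg L = max (degree N) (degree D)"
    "rf_comp L u = poly_at_rf N u / poly_at_rf D u" for u
    using rf_deg_quot rf_comp_quot by blast+
  have "a1 \<noteq> 0 \<or> b1 \<noteq> 0" using det by auto
  then have "rf_deg L = 1" using nz unfolding L by (auto simp: N_def D_def)
  moreover have "f = rf_comp L (rf_X ^ d)"
  proof -
    have pr: "poly_at_rf [:x, y:] u = rf_const x + rf_const y * u" for x y :: 'a and u
      by (simp add: poly_at_rf_def flip: ev_def) (simp add: rfc.ev_pCons rfc.ev_0)
    have fr: "to_fract (smult x ([:y, z:] ^ d)) = rf_const (x * y ^ d) + rf_const (x * z ^ d) * rf_X ^ d"
      for x y z :: 'a
    proof -
      have "smult x ([:y, z:] ^ d) = [:x:] * [:y, z:] ^ d" by simp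
      then have "to_fract (smult x ([:y, z:] ^ d)) = rf_const x * to_fract ([:y, z:] ^ d)"
        by (simp only: to_fract_mult rf_const_def)
      then show ?thesis
        by (simp only: linear_power_prime_power[OF l d2] rfc.c_mult distrib_left mult.assoc)
    qed
    have "to_fract g / to_fract h = rf_comp L (rf_X ^ d)"
      by (simp only: gh fr L N_def D_def pr)
    then show ?thesis using rf_num_den(1)[of f] by (rule trans[rotated])
  qed
  ultimately show "\<exists>L. rf_deg L = 1 \<and> f = rf_comp L (rf_X ^ d)" by blast
qed

text \<open>Condition \<open>ab\<close> places the zeros of the two linear forms at 0 and infinity,
  in one order or the other.\<close>

lemma linear_power_quotient_monomial:
  assumes gh: "g = smult \<alpha> ([:a0, a1:] ^ d)" "h = smult \<beta> ([:b0, b1:] ^ d)"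
    and nz: "\<alpha> \<noteq> 0" "\<beta> \<noteq> 0" and det: "a1 * b0 - a0 * b1 \<noteq> 0"
    and ab: "a0 = 0 \<and> b1 = 0 \<or> a1 = 0 \<and> b0 = 0"
  shows "rf_monomial f"
proof -
  have X: "(rf_X :: 'a ratfun) \<noteq> 0" by (simp add: rf_X_def)
  have "f = to_fract g / to_fract h" by (rule rf_num_den)
  also have "to_fract g = rf_const \<alpha> * (rf_const a0 + rf_const a1 * rf_X) ^ d"
    by (simp only: gh to_fract_linear_power)
  also have "to_fract h = rf_const \<beta> * (rf_const b0 + rf_const b1 * rf_X) ^ d"
    by (simp only: gh to_fract_linear_power)
  finally have f: "f = rf_const \<alpha> * (rf_const a0 + rf_const a1 * rf_X) ^ d /
    (rf_const \<beta> * (rf_const b0 + rf_const b1 * rf_X) ^ d)" .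
  from ab show ?thesis
  proof
    assume ab: "a0 = 0 \<and> b1 = 0"
    then have "f = rf_const (\<alpha> * a1 ^ d / (\<beta> * b0 ^ d)) * rf_X powi (int d)"
      by (subst f) (simp add: rfc.c_0 rfc.c_mult rfc.c_power rfc.c_divide power_mult_distrib)
    moreover have "\<alpha> * a1 ^ d / (\<beta> * b0 ^ d) \<noteq> 0" using nz det ab by auto
    ultimately show ?thesis unfolding rf_monomial_def by blast
  next
    assume ab: "a1 = 0 \<and> b0 = 0"
    have "f = rf_const (\<alpha> * a0 ^ d / (\<beta> * b1 ^ d)) * rf_X powi (- int d)"
      by (subst f) (use ab in \<open>simp add: rfc.c_0 rfc.c_mult rfc.c_power rfc.c_divide power_mult_distrib
        power_int_minus inverse_eq_divide\<close>)
    moreover have "\<alpha> * a0 ^ d / (\<beta> * b1 ^ d) \<noteq> 0" using nz det ab by auto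
    ultimately show ?thesis unfolding rf_monomial_def by blast
  qed
qed

text \<open>In the coordinates \<open>s\<close>, \<open>\<tau>\<close> given by the two linear
  forms, \<open>act\<close> raises to the power \<open>d\<close>, up to constants. Multiplying
  \<open>s\<close> by a root of unity keeps the image, and it moves \<open>r\<close> because
  \<open>act r \<notin> S\<close> makes both coordinates nonzero.\<close>

lemma other_preimage_linear_power:
  assumes gh: "g = smult \<alpha> ([:a0, a1:] ^ d)" "h = smult \<beta> ([:b0, b1:] ^ d)"
    and nz: "\<alpha> \<noteq> 0" "\<beta> \<noteq> 0" and det: "a1 * b0 - a0 * b1 \<noteq> 0"
    and z: "(z :: 'a alg_closure) \<noteq> 1" "z ^ d = 1"
    and r: "act r \<notin> S"
  shows "\<exists>r'. r' \<noteq> r \<and> act r' = act r"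
proof -
  obtain u v where uv: "u \<noteq> 0 \<or> v \<noteq> 0" "r = pt u v" by (rule pt_cases)
  define A0 A1 B0 B1 where "A0 = to_ac a0" and "A1 = to_ac a1" and "B0 = to_ac b0" and "B1 = to_ac b1"
  define \<delta> where "\<delta> = A1 * B0 - A0 * B1"
  have \<delta>: "\<delta> \<noteq> 0"
    using det unfolding \<delta>_def A0_def A1_def B0_def B1_def
    by (metis to_ac_diff to_ac_eq_0_iff to_ac_mult)
  define s \<tau> where "s = A1 * u + A0 * v" and "\<tau> = B1 * u + B0 * v"
  have act_r: "act r = pt (to_ac \<alpha> * s ^ d) (to_ac \<beta> * \<tau> ^ d)"
    unfolding uv(2) s_def \<tau>_def A0_def A1_def B0_def B1_def by (rule act_linear_power[OF gh uv(1)])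
  have st: "s \<noteq> 0" "\<tau> \<noteq> 0"
    using r deg_pos nz unfolding act_r by (auto simp: pt_def power_0_left split: if_splits)
  \<comment> \<open>Cramer's rule for the point with coordinates \<open>z * s\<close> and
    \<open>\<tau>\<close>.\<close>
  define u' v' where "u' = (B0 * (z * s) - A0 * \<tau>) / \<delta>" and "v' = (A1 * \<tau> - B1 * (z * s)) / \<delta>"
  have s': "A1 * u' + A0 * v' = z * s"
  proof -
    have "A1 * u' + A0 * v' = (A1 * (B0 * (z * s) - A0 * \<tau>) + A0 * (A1 * \<tau> - B1 * (z * s))) / \<delta>"
      by (simp add: u'_def v'_def add_divide_distrib)
    also have "\<dots> = (\<delta> * (z * s)) / \<delta>" by (simp add: \<delta>_def algebra_simps)
    finally show ?thesis using \<delta> by simp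
  qed
  have \<tau>': "B1 * u' + B0 * v' = \<tau>"
  proof -
    have "B1 * u' + B0 * v' = (B1 * (B0 * (z * s) - A0 * \<tau>) + B0 * (A1 * \<tau> - B1 * (z * s))) / \<delta>"
      by (simp add: u'_def v'_def add_divide_distrib)
    also have "\<dots> = (\<delta> * \<tau>) / \<delta>" by (simp add: \<delta>_def algebra_simps)
    finally show ?thesis using \<delta> by simp
  qed
  have uv': "u' \<noteq> 0 \<or> v' \<noteq> 0" using \<tau>' st by auto
  have "act (pt u' v') = pt (to_ac \<alpha> * (z * s) ^ d) (to_ac \<beta> * \<tau> ^ d)"
    using act_linear_power[OF gh uv'] s' \<tau>' by (simp add: A0_def A1_def B0_def B1_def)
  then have "act (pt u' v') = act r" by (simp add: act_r power_mult_distrib z)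
  moreover have "pt u' v' \<noteq> r"
  proof
    assume "pt u' v' = r"
    then have "u' * v = u * v'" using pt_eqD[OF uv' uv(1)] uv(2) by simp
    moreover have "(A1 * u' + A0 * v') * \<tau> - s * (B1 * u' + B0 * v') = \<delta> * (u' * v - u * v')"
      by (simp add: s_def \<tau>_def \<delta>_def algebra_simps)
    ultimately have "z * s * \<tau> = s * \<tau>" unfolding s' \<tau>' by simp
    then show False using st z by simp
  qed
  ultimately show ?thesis by blast
qed

text \<open>With no new point at time \<open>t\<close>, \<open>act\<close> is injective on
  \<open>orb\<close>, and 0 and infinity have one preimage each. The loss is then a single factor
  \<open>d\<close>, because a new point two steps before \<open>S\<close> counts with multiplicity
  \<open>d\<close>.\<close>

lemma Psi_ge_exceptional:
  assumes d2: "d \<ge> 2" and not_mono: "\<not> rf_monomial f"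
    and not_frob: "rf_separable f \<or>
      \<not> (\<exists>L l. rf_deg L = 1 \<and> l \<ge> (1::nat) \<and> f = rf_comp L (rf_X ^ (CHAR('a) ^ l)))"
    and t: "t \<ge> 1" and no: "\<And>y. Some y \<notin> orb \<Longrightarrow> (act ^^ t) (Some y) \<notin> S"
    and n: "n \<ge> 2"
  shows "d ^ (n - 1) \<le> Psi f n"
proof -
  have orb: "\<And>u. act u \<in> S \<Longrightarrow> u \<in> orb" "\<And>z. z \<in> orb \<Longrightarrow> \<exists>z'\<in>orb. act z' = z" "inj_on act orb"
    using preimages_in_orbit[OF t] no by blast+
  have uniq: "u = u'" if "act u = act u'" "act u \<in> S" for u u'
    using inj_onD[OF orb(3) that(1)] orb(1)[of u] orb(1)[of u'] that by simp
  obtain z0 where z0: "act z0 = Some 0" using surj_act by (metis surjD)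
  obtain z1 where z1: "act z1 = None" using surj_act by (metis surjD)
  have in_orb: "z0 \<in> orb" "z1 \<in> orb" using orb(1) z0 z1 by auto
  have u0: "act u = Some 0 \<longleftrightarrow> u = z0" for u using uniq[of u z0] z0 by auto
  have u1: "act u = None \<longleftrightarrow> u = z1" for u using uniq[of u z1] z1 by auto
  obtain \<alpha> a0 a1 where A: "\<alpha> \<noteq> 0" "g = smult \<alpha> ([:a0, a1:] ^ d)" "z0 = pt (to_ac (- a0)) (to_ac a1)"
    "a0 \<noteq> 0 \<or> a1 \<noteq> 0" by (rule totally_ramified_num[OF u0 in_orb(1)])
  obtain \<beta> b0 b1 where B: "\<beta> \<noteq> 0" "h = smult \<beta> ([:b0, b1:] ^ d)" "z1 = pt (to_ac (- b0)) (to_ac b1)"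
    "b0 \<noteq> 0 \<or> b1 \<noteq> 0" by (rule totally_ramified_den[OF u1 in_orb(2)])
  have det: "a1 * b0 - a0 * b1 \<noteq> 0"
  proof
    assume "a1 * b0 - a0 * b1 = 0"
    then have "(- a0) * b1 = (- b0) * a1" by (simp add: mult.commute)
    then have "to_ac (- a0) * to_ac b1 = to_ac (- b0) * to_ac a1" by (metis to_ac_mult)
    then have "z0 = z1"
      unfolding A(3) B(3) by (intro pt_eqI) (use A(4) B(4) in auto)
    then show False using z0 z1 by simp
  qed
  have "d \<noteq> CHAR('a) ^ l" for l
  proof
    assume l: "d = CHAR('a) ^ l"
    note * = linear_power_quotient_frobenius[OF A(2) B(2) A(1) B(1) det l d2]
    have "l \<ge> 1" using prime_power_char(2)[OF l d2] .
    with * not_frob l show False by metis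
  qed
  then obtain \<zeta> :: "'a alg_closure" where \<zeta>: "\<zeta> \<noteq> 1" "\<zeta> ^ d = 1"
    using root_of_unity[where 'k = "'a alg_closure", of d] d2 by auto
  \<comment> \<open>One of \<open>z0\<close>, \<open>z1\<close> is neither 0 nor infinity: otherwise
    they would be 0 and infinity in some order, and \<open>f\<close> a monomial.\<close>
  have "\<exists>v\<in>S. \<exists>w. w \<noteq> 0 \<and> Some (to_ac w) \<in> orb \<and> (\<forall>u. act u = v \<longrightarrow> u = Some (to_ac w))"
  proof (rule ccontr)
    assume not: "\<not> ?thesis"
    have "z0 \<in> S"
    proof (rule ccontr)
      assume "z0 \<notin> S"
      then obtain w where w: "z0 = Some (to_ac w)" using act_rational[OF in_orb(1)] by auto
      with \<open>z0 \<notin> S\<close> have "w \<noteq> 0" by auto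
      with w not u0 in_orb show False by blast
    qed
    moreover have "z1 \<in> S"
    proof (rule ccontr)
      assume "z1 \<notin> S"
      then obtain w where w: "z1 = Some (to_ac w)" using act_rational[OF in_orb(2)] by auto
      with \<open>z1 \<notin> S\<close> have "w \<noteq> 0" by auto
      with w not u1 in_orb show False by blast
    qed
    moreover have "z0 \<noteq> z1" using z0 z1 by auto
    ultimately have "z0 = Some 0 \<and> z1 = None \<or> z0 = None \<and> z1 = Some 0" by blast
    then have "a0 = 0 \<and> b1 = 0 \<or> a1 = 0 \<and> b0 = 0"
      unfolding A(3) B(3) by (auto simp: pt_def split: if_splits)
    then show False using linear_power_quotient_monomial[OF A(2) B(2) A(1) B(1) det] not_mono by blast
  qed
  then obtain v w where v: "v \<in> S" "w \<noteq> 0" "Some (to_ac w) \<in> orb"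
    "\<And>u. act u = v \<Longrightarrow> u = Some (to_ac w)" by blast
  \<comment> \<open>Injectivity on \<open>orb\<close> keeps a second preimage \<open>r'\<close> of
    \<open>w\<close> outside \<open>orb\<close>; it is finite because infinity is in
    \<open>orb\<close>.\<close>
  obtain r where r: "r \<in> orb" "act r = Some (to_ac w)" using orb(2)[OF v(3)] by blast
  have "act r \<notin> S" using r v by auto
  then obtain r' where r': "r' \<noteq> r" "act r' = act r"
    using other_preimage_linear_power[OF A(2) B(2) A(1) B(1) det \<zeta>] by blast
  then have "r' \<notin> orb" using inj_onD[OF orb(3) r'(2)] r by blast
  moreover from this obtain x where x: "r' = Some x" using orbI[of None 0] by (cases r') auto
  ultimately have x': "act (Some x) = Some (to_ac w)" "Some x \<notin> orb" using r r' by simp_all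
  show ?thesis
    by (rule Psi_geI, rule degree_prod_ge_ramified[OF v(1) v(4) v(2) x']) (use n in auto)
qed

text \<open>The defect \<open>j\<close> is 0 if \<open>S\<close> never returns to itself, the first
  return time \<open>t\<close> if a new point reaches \<open>S\<close> at time \<open>t\<close>, and
  1 otherwise.\<close>

lemma Psi_ge_finite_defect:
  assumes d2: "d \<ge> 2" and not_mono: "\<not> rf_monomial f"
    and not_frob: "rf_separable f \<or>
      \<not> (\<exists>L l. rf_deg L = 1 \<and> l \<ge> (1::nat) \<and> f = rf_comp L (rf_X ^ (CHAR('a) ^ l)))"
  shows "\<exists>j. \<forall>n\<ge>1. (n \<le> j \<longrightarrow> d ^ n \<le> Psi f n) \<and> (n > j \<longrightarrow> d ^ (n - j) \<le> Psi f n)"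
proof -
  define ret where "ret i \<longleftrightarrow> 0 < i \<and> (\<exists>s\<in>S. (act ^^ i) s \<in> S)" for i
  have small: "d ^ n \<le> Psi f n" if "n \<ge> 1" "\<And>i. i < n \<Longrightarrow> \<not> ret i" for n
    by (rule Psi_geI, rule degree_prod_ge_no_return) (use that in \<open>auto simp: ret_def\<close>)
  show ?thesis
  proof (cases "\<exists>i. ret i")
    case False
    then show ?thesis using small by (intro exI[of _ 0]) auto
  next
    case True
    define t where "t = (LEAST i. ret i)"
    have ret_t: "ret t" unfolding t_def using True by (rule LeastI_ex)
    have min: "\<not> ret i" if "i < t" for i using that unfolding t_def by (rule not_less_Least)
    have t: "t \<ge> 1" using ret_t by (simp add: ret_def)
    have small': "d ^ n \<le> Psi f n" if "n \<ge> 1" "n \<le> t" for n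
      using small[OF that(1)] min that(2) by auto
    show ?thesis
    proof (cases "\<exists>y. Some y \<notin> orb \<and> (act ^^ t) (Some y) \<in> S")
      case True
      then obtain y where y: "Some y \<notin> orb" "(act ^^ t) (Some y) \<in> S" by blast
      \<comment> \<open>A visit to \<open>S\<close> at time \<open>i\<close> would be followed by a
        return after only \<open>t - i\<close> steps.\<close>
      have H: "(act ^^ i) (Some y') \<notin> S"
        if "(act ^^ t) (Some y') = (act ^^ t) (Some y)" "0 < i" "i < t" for y' i
      proof
        assume "(act ^^ i) (Some y') \<in> S"
        moreover have "(act ^^ ((t - i) + i)) (Some y') \<in> S" using that y by simp
        then have "(act ^^ (t - i)) ((act ^^ i) (Some y')) \<in> S" by (simp only: act_funpow_add)
        ultimately have "ret (t - i)" using that unfolding ret_def by auto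
        then show False using min[of "t - i"] that by simp
      qed
      have "d ^ (n - t) \<le> Psi f n" if "n \<ge> 1" "n > t" for n
        by (rule Psi_geI, rule degree_prod_ge_new_point[OF y H]) (use that in auto)
      with small' show ?thesis by blast
    next
      case False
      then have no: "(act ^^ t) (Some y) \<notin> S" if "Some y \<notin> orb" for y using that by blast
      have "d ^ (n - 1) \<le> Psi f n" if "n > 1" for n
        using Psi_ge_exceptional[OF d2 not_mono not_frob t no] that by simp
      \<comment> \<open>With defect 1 the case \<open>n = 1\<close> still needs the full bound,
        available because \<open>1 \<le> t\<close>.\<close>
      moreover have "d ^ n \<le> Psi f n" if "n \<ge> 1" "n \<le> 1" for n
        using small'[of n] t that by simp
      ultimately show ?thesis by blast
    qed
  qed
qed

end

section \<open>Bounds in terms of \<open>zero_index\<close>, and the conclusion\<close>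

lemma (in polymap) Psi_ge_polynomial:
  assumes not_mono: "\<not> rf_monomial f"
    and not_binom: "\<not> (\<exists>a b (l::nat). a \<noteq> 0 \<and> f = rf_const a * rf_X ^ (CHAR('a) ^ l) + rf_const b)"
    and n: "n \<ge> 1"
  shows "enat n \<le> zero_index f \<Longrightarrow> d ^ n \<le> Psi f n"
    and "enat n > zero_index f \<Longrightarrow> d ^ (n - the_enat (zero_index f)) \<le> Psi f n"
proof -
  define ret where "ret k \<longleftrightarrow> k > 0 \<and> (act ^^ k) (Some 0) = Some 0" for k
  have zi: "zero_index f = (if \<exists>k. ret k then enat (LEAST k. ret k) else \<infinity>)"
    by (simp add: zero_index_def zero_at_0_iter ret_def)
  have min: "\<not> ret i" if "enat i < zero_index f" for i
  proof
    assume i: "ret i"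
    then have "zero_index f = enat (LEAST k. ret k)" by (auto simp: zi)
    with that i show False by (auto dest: not_less_Least)
  qed
  show "d ^ n \<le> Psi f n" if le: "enat n \<le> zero_index f"
  proof (rule Psi_ge_before_return[OF n])
    fix i assume "0 < i" "i < n"
    then have "enat i < zero_index f" using le by (meson enat_ord_simps(2) less_le_trans)
    then show "(act ^^ i) (Some 0) \<noteq> Some 0" using min[of i] \<open>0 < i\<close> by (simp add: ret_def)
  qed
  show "d ^ (n - the_enat (zero_index f)) \<le> Psi f n" if gt: "enat n > zero_index f"
  proof -
    \<comment> \<open>The strict bound makes \<open>zero_index f\<close> finite, so
      \<open>the_enat\<close> returns its actual value.\<close>
    obtain e where e: "zero_index f = enat e" using gt by (cases "zero_index f") auto
    then have ex: "\<exists>k. ret k" and e': "e = (LEAST k. ret k)" by (auto simp: zi split: if_splits)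
    have "ret e" unfolding e' using ex by (rule LeastI_ex)
    then have 1: "e \<ge> 1" "(act ^^ e) (Some 0) = Some 0" by (auto simp: ret_def)
    have 2: "(act ^^ i) (Some 0) \<noteq> Some 0" if "0 < i" "i < e" for i
      using min[of i] that by (simp add: e ret_def)
    obtain y where y: "y \<noteq> 0" "(act ^^ e) (Some y) = Some 0"
      using other_preimage_of_0[OF not_mono not_binom 1 2] by blast
    have "d ^ (n - e) \<le> Psi f n"
      by (rule Psi_ge_after_return[OF y 1(2) 2]) (use n gt e in auto)
    then show ?thesis by (simp add: e)
  qed
qed

theorem theorem1:
  fixes f :: "'a::field ratfun"
  defines "d \<equiv> rf_deg f"
      and "g \<equiv> rf_num f"
      and "h \<equiv> rf_den f"
      and "p \<equiv> CHAR('a)"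
  assumes deg2: "d \<ge> 2"
      and not_mono: "\<not> rf_monomial f"
      and not_binom: "\<not> (\<exists>a b (l::nat). a \<noteq> 0 \<and> f = rf_const a * rf_X ^ (p ^ l) + rf_const b)"
      and not_conj: "\<not> lin_conj (inverse (rf_X ^ d)) f"
  shows
    "((\<exists>q. f = to_fract q) \<longrightarrow>
        (\<forall>n\<ge>1. (enat n \<le> zero_index f \<longrightarrow> Psi f n \<ge> d ^ n) \<and>
                (enat n > zero_index f \<longrightarrow> Psi f n \<ge> d ^ (n - the_enat (zero_index f)))))
   \<and> ((degree g > degree h \<and> degree h \<ge> 1 \<or> 1 \<le> degree g \<and> degree g < degree h) \<longrightarrow>
        (\<forall>n\<ge>1. Psi f n \<ge> d ^ (n - 1)))
   \<and> ((degree g = 0 \<and> 0 < degree h \<or> degree g = degree h) \<longrightarrow>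
       (rf_separable f \<or>
        \<not> (\<exists>L (l::nat). rf_deg L = 1 \<and> l \<ge> 1 \<and> f = rf_comp L (rf_X ^ (p ^ l)))) \<longrightarrow>
       (\<exists>j::nat. \<forall>n\<ge>1. (n \<le> j \<longrightarrow> Psi f n \<ge> d ^ n) \<and> (n > j \<longrightarrow> Psi f n \<ge> d ^ (n - j))))"
proof -
  interpret ratmap f
    by unfold_locales (use deg2 in \<open>simp add: d_def\<close>)
  have "(enat n \<le> zero_index f \<longrightarrow> d ^ n \<le> Psi f n) \<and>
      (enat n > zero_index f \<longrightarrow> d ^ (n - the_enat (zero_index f)) \<le> Psi f n)"
    if q: "\<exists>q. f = to_fract q" and n: "n \<ge> 1" for n
  proof -
    have "rf_den f = 1" using q rf_num_den_to_fract(2) by blast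
    then interpret polymap f
      by unfold_locales (use deg2 in \<open>simp_all add: d_def\<close>)
    show ?thesis
      using Psi_ge_polynomial[OF not_mono not_binom[unfolded p_def] n] by (simp add: d_def)
  qed
  moreover have "d ^ (n - 1) \<le> Psi f n"
    if "degree g > degree h \<and> degree h \<ge> 1 \<or> 1 \<le> degree g \<and> degree g < degree h" "n \<ge> 1" for n
    unfolding d_def by (rule Psi_ge_mixed) (use that in \<open>simp_all only: g_def h_def\<close>)
  moreover have "\<exists>j::nat. \<forall>n\<ge>1. (n \<le> j \<longrightarrow> d ^ n \<le> Psi f n) \<and> (n > j \<longrightarrow> d ^ (n - j) \<le> Psi f n)"
    if "rf_separable f \<or> \<not> (\<exists>L (l::nat). rf_deg L = 1 \<and> l \<ge> 1 \<and> f = rf_comp L (rf_X ^ (p ^ l)))"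
    unfolding d_def
    by (rule Psi_ge_finite_defect[OF deg2[unfolded d_def] not_mono that[unfolded p_def]])
  ultimately show ?thesis by blast
qed

end
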